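(* Let $K,F\subset\mathbb{R}^d$ be two dust-like self-similar sets with the same Hausdorff dimension $s$. If $K$ is homogeneous and there is a Lipschitz map $f: K\to F$ with $\mathcal{H}^s(f(K))>0$, then $K$ and $F$ are Lipschitz equivalent.
   Context: A self-similar set $K\subset\mathbb{R}^d$ is the attractor (the unique non-empty compact set with $K=\bigcup_{i=1}^n\varphi_i(K)$) of a finite iterated function system (IFS) $\Phi=\{\varphi_i\}_{i=1}^n$, where each $\varphi_i:\mathbb{R}^d\to\mathbb{R}^d$ is a contractive similitude (i.e. $|\varphi_i(x)-\varphi_i(y)|=r_i|x-y|$ for all $x,y$, with contraction ratio $r_i\in(0,1)$). It is called dust-like if $n\ge 2$ and the images $\varphi_1(K),\dots,\varphi_n(K)$ are pairwise disjoint (the strong separation condition, SSC). A dust-like self-similar set is homogeneous if all similitudes in the associated IFS share a common contraction ratio. $\mathcal{H}^s$ denotes the $s$-dimensional Hausdorff measure. Sets $A,B\subset\mathbb{R}^d$ are Lipschitz equivalent if there are a bijection $f:A\to B$ and a constant $c>0$ with $c^{-1}|x-y|\le|f(x)-f(y)|\le c|x-y|$ for all $x,y\in A$. *)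

theory Defs
  imports "HOL-Analysis.Analysis"
begin

text \<open>
  The \<open>s\<close>-th power of the diameter, with the usual conventions that the empty set has weight
  \<open>0\<close> and that \<open>0\<^sup>0 = 1\<close> for non-empty sets (whereas \<open>0 powr 0 = 0\<close>).
  Only meant for bounded sets, since \<open>diameter\<close> is unspecified on unbounded ones.
\<close>

definition diam_pow :: "real \<Rightarrow> 'a::metric_space set \<Rightarrow> real" where
  "diam_pow s U = (if U = {} then 0 else if s = 0 then 1 else diameter U powr s)"

definition hausdorff_content :: "real \<Rightarrow> real \<Rightarrow> 'a::metric_space set \<Rightarrow> ennreal" where
  "hausdorff_content \<delta> s E =
     (INF U \<in> {U :: nat \<Rightarrow> 'a set. E \<subseteq> (\<Union>i. U i) \<and> (\<forall>i. bounded (U i) \<and> diameter (U i) \<le> \<delta>)}.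
        \<Sum>i. ennreal (diam_pow s (U i)))"

text \<open>
  The content is antitone in \<open>\<delta>\<close>, so the limit for \<open>\<delta> \<rightarrow> 0\<close> is a supremum. No normalising
  constant is used.
\<close>

definition hausdorff_measure :: "real \<Rightarrow> 'a::metric_space set \<Rightarrow> ennreal" where
  "hausdorff_measure s E = (SUP \<delta> \<in> {0<..}. hausdorff_content \<delta> s E)"

definition hausdorff_dim :: "'a::metric_space set \<Rightarrow> ereal" where
  "hausdorff_dim E = (INF s \<in> {s. 0 \<le> s \<and> hausdorff_measure s E = 0}. ereal s)"

definition contractive_similitude :: "real \<Rightarrow> ('a::metric_space \<Rightarrow> 'a) \<Rightarrow> bool" where
  "contractive_similitude r \<phi> \<longleftrightarrow>
     0 < r \<and> r < 1 \<and> (\<forall>x y. dist (\<phi> x) (\<phi> y) = r * dist x y)"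

text \<open>An IFS is given by its number \<open>n\<close> of maps, the ratios \<open>r i\<close> and the maps \<open>\<phi> i\<close>, \<open>1 \<le> i \<le> n\<close>.\<close>

definition similitude_ifs :: "nat \<Rightarrow> (nat \<Rightarrow> real) \<Rightarrow> (nat \<Rightarrow> 'a::metric_space \<Rightarrow> 'a) \<Rightarrow> bool" where
  "similitude_ifs n r \<phi> \<longleftrightarrow> (\<forall>i\<in>{1..n}. contractive_similitude (r i) (\<phi> i))"

definition is_attractor :: "nat \<Rightarrow> (nat \<Rightarrow> 'a::metric_space \<Rightarrow> 'a) \<Rightarrow> 'a set \<Rightarrow> bool" where
  "is_attractor n \<phi> K \<longleftrightarrow> K \<noteq> {} \<and> compact K \<and> K = (\<Union>i\<in>{1..n}. \<phi> i ` K)"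

definition dust_like_ifs ::
    "nat \<Rightarrow> (nat \<Rightarrow> real) \<Rightarrow> (nat \<Rightarrow> 'a::metric_space \<Rightarrow> 'a) \<Rightarrow> 'a set \<Rightarrow> bool" where
  "dust_like_ifs n r \<phi> K \<longleftrightarrow>
     2 \<le> n \<and> similitude_ifs n r \<phi> \<and> is_attractor n \<phi> K \<and>
     disjoint_family_on (\<lambda>i. \<phi> i ` K) {1..n}"

definition dust_like :: "'a::metric_space set \<Rightarrow> bool" where
  "dust_like K \<longleftrightarrow> (\<exists>n r \<phi>. dust_like_ifs n r \<phi> K)"

definition homogeneous_dust_like :: "'a::metric_space set \<Rightarrow> bool" where
  "homogeneous_dust_like K \<longleftrightarrow>
     (\<exists>n r \<phi>. dust_like_ifs n r \<phi> K \<and> (\<forall>i\<in>{1..n}. \<forall>j\<in>{1..n}. r i = r j))"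

definition lipschitz_equivalent :: "'a::metric_space set \<Rightarrow> 'b::metric_space set \<Rightarrow> bool" where
  "lipschitz_equivalent A B \<longleftrightarrow>
     (\<exists>f c. bij_betw f A B \<and> c > 0 \<and>
        (\<forall>x\<in>A. \<forall>y\<in>A. inverse c * dist x y \<le> dist (f x) (f y) \<and> dist (f x) (f y) \<le> c * dist x y))"

end

theory Submission
  imports Defs "HOL-Computational_Algebra.Nth_Powers" "HOL-Library.Sublist"
begin

text \<open>
  Write \<open>r\<close> for the common ratio of the \<open>n\<close> similitudes of \<open>K\<close>, and \<open>t\<^sub>1, \<dots>, t\<^sub>m\<close> for the ratios
  of \<open>F\<close>. Equality of the dimensions with \<open>s\<close> means \<open>n r^s = 1\<close> and \<open>t\<^sub>1^s + \<dots> + t\<^sub>m^s = 1\<close>, so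
  \<open>r^s\<close> and \<open>t\<^sub>j^s\<close> are the weights of the natural probability measures \<open>\<mu>\<close> on \<open>K\<close> and \<open>\<nu>\<close> on
  \<open>F\<close>. The proof has an arithmetic half and a geometric half.

  \<^bold>\<open>Arithmetic.\<close> The Lipschitz map forces \<open>t\<^sub>j^s\<close> to be the reciprocal of an integer, some power of
  which is a power of \<open>n\<close>. The preimage under \<open>f\<close> of a cylinder \<open>V\<close> of \<open>F\<close> is a union of cylinders
  of \<open>K\<close> of diameter comparable to that of \<open>V\<close>, because \<open>f\<close> cannot jump over the gap around \<open>V\<close>.
  Hence \<open>\<mu>(f\<^sup>-\<^sup>1 V)\<close> is an integer multiple of a power of \<open>1/n\<close> that is comparable to \<open>\<nu>(V)\<close>. As \<open>f(K)\<close>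
  has positive measure, some \<open>V\<close> is hit by \<open>f(K)\<close> in all its descendants down to any prescribed depth,
  while \<open>\<mu>(f\<^sup>-\<^sup>1 V)/\<nu>(V)\<close> stays bounded (lemma \<open>saturated_vertex\<close>). This density is also bounded
  below on cylinders that are hit, so repeatedly passing to a descendant of much smaller density must
  stop (lemma \<open>descent\<close>). It stops at a \<open>V\<close> on which the density is almost constant, and there
  \<open>\<nu>(V\<^sub>u)/\<nu>(V)\<close>, the weight of the word \<open>u\<close>, is almost \<open>(a/b) n^(-e)\<close> with integers \<open>a, b\<close> whose bound
  does not depend on \<open>u\<close>. Since such numbers cannot accumulate at a positive limit, the equality is
  exact (lemma \<open>weights_rational_of_bounded_height\<close>). For \<open>u = j\<dots>j\<close> two different lengths share the
  same \<open>a, b\<close>, so a power of \<open>t\<^sub>j^s\<close> is a power of \<open>1/n\<close>; and \<open>t\<^sub>j^s\<close> itself is rational (lemma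
  \<open>weight_is_integer_reciprocal\<close>).

  \<^bold>\<open>Geometry.\<close> Consequently there is one integer \<open>a\<close> with \<open>n = a^\<alpha>\<close> and \<open>t\<^sub>j^s = a^(-\<beta>\<^sub>j)\<close> (lemma
  \<open>common_base\<close>). The identity \<open>a^(-\<beta>\<^sub>1) + \<dots> + a^(-\<beta>\<^sub>m) = 1\<close> is the equality case of Kraft's
  inequality, so there is a complete prefix code over \<open>a\<close> letters with word lengths \<open>\<beta>\<^sub>j\<close>. Reading
  addresses of points of \<open>F\<close> through this code identifies \<open>F\<close> with the standard \<open>a\<close>-adic Cantor set of
  ratio \<open>a^(-1/s)\<close>, up to bounded distortion (lemma \<open>ex_cantor_tree\<close>). The same applies to \<open>K\<close>, whose
  lengths are all \<open>\<alpha>\<close>, and two sets with such an identification are Lipschitz equivalent.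
\<close>

section \<open>Words and cylinders\<close>

definition words :: "nat \<Rightarrow> nat \<Rightarrow> nat list set" where
  "words n k = {w. set w \<subseteq> {1..n} \<and> length w = k}"

lemma finite_words [simp]: "finite (words n k)"
  unfolding words_def by (rule finite_lists_length_eq) simp

lemma card_words [simp]: "card (words n k) = n ^ k"
  unfolding words_def by (subst card_lists_length_eq) auto

lemma words_0 [simp]: "words n 0 = {[]}"
  by (auto simp: words_def)

lemma sum_words_add:
  fixes h :: "nat list \<Rightarrow> 'b::comm_monoid_add"
  shows "(\<Sum>w\<in>words n (k + l). h w) = (\<Sum>u\<in>words n k. \<Sum>v\<in>words n l. h (u @ v))"
proof -
  have "(\<Sum>u\<in>words n k. \<Sum>v\<in>words n l. h (u @ v)) =
      (\<Sum>p\<in>words n k \<times> words n l. h (fst p @ snd p))"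
    by (simp add: sum.cartesian_product case_prod_beta)
  also have "\<dots> = (\<Sum>w\<in>words n (k + l). h w)"
  proof (rule sum.reindex_bij_witness[where i = "\<lambda>w. (take k w, drop k w)"
        and j = "\<lambda>p. fst p @ snd p"])
    fix w assume "w \<in> words n (k + l)"
    then show "(take k w, drop k w) \<in> words n k \<times> words n l"
      by (auto simp: words_def dest: in_set_takeD in_set_dropD)
  qed (auto simp: words_def)
  finally show ?thesis ..
qed

lemma words_1: "words n 1 = (\<lambda>i. [i]) ` {1..n}"
  by (auto simp: words_def length_Suc_conv)

lemma sum_words_1:
  fixes h :: "nat list \<Rightarrow> 'b::comm_monoid_add"
  shows "(\<Sum>w\<in>words n 1. h w) = (\<Sum>i\<in>{1..n}. h [i])"
  unfolding words_1 by (subst sum.reindex) (auto simp: inj_on_def)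

lemma sum_words_Suc:
  fixes h :: "nat list \<Rightarrow> 'b::comm_monoid_add"
  shows "(\<Sum>w\<in>words n (Suc k). h w) = (\<Sum>u\<in>words n k. \<Sum>i\<in>{1..n}. h (u @ [i]))"
  using sum_words_add[of h n k 1] sum_words_1[of "\<lambda>v. h (u @ v)" n for u] by simp

lemma sum_words_prod_list:
  fixes p :: "nat \<Rightarrow> real"
  shows "(\<Sum>w\<in>words n k. prod_list (map p w)) = (\<Sum>i\<in>{1..n}. p i) ^ k"
proof (induction k)
  case (Suc k)
  then show ?case
    by (simp only: sum_words_Suc) (simp add: sum_distrib_left[symmetric] sum_distrib_right[symmetric])
qed simp

lemma wordsD: "w \<in> words n k \<Longrightarrow> set w \<subseteq> {1..n}"
  by (simp add: words_def)

lemma words_append: "u \<in> words n k \<Longrightarrow> v \<in> words n l \<Longrightarrow> u @ v \<in> words n (k + l)"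
  by (auto simp: words_def)

primrec word_map :: "(nat \<Rightarrow> 'a \<Rightarrow> 'a) \<Rightarrow> nat list \<Rightarrow> 'a \<Rightarrow> 'a" where
  "word_map \<phi> [] = id"
| "word_map \<phi> (i # w) = \<phi> i \<circ> word_map \<phi> w"

lemma word_map_append: "word_map \<phi> (u @ v) = word_map \<phi> u \<circ> word_map \<phi> v"
  by (induction u) (auto simp: o_assoc)

locale dust_ifs =
  fixes n :: nat and r :: "nat \<Rightarrow> real" and \<phi> :: "nat \<Rightarrow> 'a::heine_borel \<Rightarrow> 'a" and K :: "'a set"
  assumes dust: "dust_like_ifs n r \<phi> K"
begin

definition ratio :: "nat list \<Rightarrow> real" where
  "ratio w = prod_list (map r w)"

definition cyl :: "nat list \<Rightarrow> 'a set" where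
  "cyl w = word_map \<phi> w ` K"

lemma two_le_n: "2 \<le> n"
  using dust by (simp add: dust_like_ifs_def)

lemma r_bounds: "i \<in> {1..n} \<Longrightarrow> 0 < r i" "i \<in> {1..n} \<Longrightarrow> r i < 1"
  using dust by (auto simp: dust_like_ifs_def similitude_ifs_def contractive_similitude_def)

lemma K_nonempty: "K \<noteq> {}" and K_compact: "compact K"
  and K_fixed: "K = (\<Union>i\<in>{1..n}. \<phi> i ` K)"
  using dust by (simp_all add: dust_like_ifs_def is_attractor_def)

lemma dist_map: "i \<in> {1..n} \<Longrightarrow> dist (\<phi> i x) (\<phi> i y) = r i * dist x y"
  using dust by (auto simp: dust_like_ifs_def similitude_ifs_def contractive_similitude_def)

lemma ratio_Nil [simp]: "ratio [] = 1"
  and ratio_Cons [simp]: "ratio (i # w) = r i * ratio w"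
  and ratio_append [simp]: "ratio (u @ v) = ratio u * ratio v"
  by (simp_all add: ratio_def)

lemma ratio_pos: "set w \<subseteq> {1..n} \<Longrightarrow> 0 < ratio w"
  by (induction w) (auto intro!: mult_pos_pos r_bounds)

lemma ratio_le_1: "set w \<subseteq> {1..n} \<Longrightarrow> ratio w \<le> 1"
proof (induction w)
  case (Cons i w)
  then show ?case
    using r_bounds[of i] ratio_pos[of w] by (auto intro!: mult_le_one)
qed simp

lemma dist_word_map:
  "set w \<subseteq> {1..n} \<Longrightarrow> dist (word_map \<phi> w x) (word_map \<phi> w y) = ratio w * dist x y"
  by (induction w) (auto simp: dist_map)

lemma cyl_Nil [simp]: "cyl [] = K"
  by (simp add: cyl_def)

lemma cyl_append: "cyl (u @ v) = word_map \<phi> u ` cyl v"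
  by (simp add: cyl_def word_map_append image_comp)

lemma K_eq_cyl: "K = (\<Union>i\<in>{1..n}. cyl [i])"
  using K_fixed by (simp add: cyl_def)

lemma cyl_snoc: "cyl u = (\<Union>i\<in>{1..n}. cyl (u @ [i]))"
proof -
  have "cyl u = word_map \<phi> u ` K"
    by (simp add: cyl_def)
  also have "\<dots> = word_map \<phi> u ` (\<Union>i\<in>{1..n}. cyl [i])"
    by (rule arg_cong[OF K_eq_cyl])
  finally show ?thesis
    by (simp add: cyl_append image_UN)
qed

lemma cyl_extend: "cyl u = (\<Union>v\<in>words n k. cyl (u @ v))"
proof (induction k)
  case (Suc k)
  have "cyl u = (\<Union>v\<in>words n k. \<Union>i\<in>{1..n}. cyl (u @ v @ [i]))"
    unfolding Suc by (intro SUP_cong refl) (subst cyl_snoc, simp)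
  also have "\<dots> = (\<Union>v\<in>words n (Suc k). cyl (u @ v))"
  proof (intro equalityI subsetI)
    fix x assume "x \<in> (\<Union>v\<in>words n k. \<Union>i\<in>{1..n}. cyl (u @ v @ [i]))"
    then obtain v i where "v \<in> words n k" "i \<in> {1..n}" "x \<in> cyl (u @ v @ [i])"
      by auto
    then show "x \<in> (\<Union>v\<in>words n (Suc k). cyl (u @ v))"
      by (intro UN_I[of "v @ [i]"]) (auto simp: words_def)
  next
    fix x assume "x \<in> (\<Union>v\<in>words n (Suc k). cyl (u @ v))"
    then obtain v where v: "v \<in> words n (Suc k)" "x \<in> cyl (u @ v)"
      by auto
    then obtain v' i where vi: "v = v' @ [i]"
      by (cases v rule: rev_cases) (auto simp: words_def)
    with v have "v' \<in> words n k" "i \<in> {1..n}" "x \<in> cyl (u @ v' @ [i])"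
      by (auto simp: words_def)
    then show "x \<in> (\<Union>v\<in>words n k. \<Union>i\<in>{1..n}. cyl (u @ v @ [i]))"
      by blast
  qed
  finally show ?case .
qed simp

lemma K_eq_words: "K = (\<Union>v\<in>words n k. cyl v)"
  using cyl_extend[of "[]" k] unfolding cyl_Nil append_Nil .

lemma ex_word_cyl: "x \<in> K \<Longrightarrow> \<exists>v\<in>words n k. x \<in> cyl v"
  using K_eq_words[of k] by blast

lemma cyl_append_subset: "set v \<subseteq> {1..n} \<Longrightarrow> cyl (u @ v) \<subseteq> cyl u"
  using cyl_extend[of u "length v"] by (auto simp: words_def)

lemma cyl_subset: "set v \<subseteq> {1..n} \<Longrightarrow> cyl v \<subseteq> K"
  using cyl_append_subset[of v "[]"] by simp

lemma cyl_nonempty: "cyl w \<noteq> {}"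
  using K_nonempty by (simp add: cyl_def)

lemma cyl_compact: 
  assumes "set w \<subseteq> {1..n}" shows "compact (cyl w)"
proof -
  have "(ratio w)-lipschitz_on K (word_map \<phi> w)"
    using assms by (intro lipschitz_onI) (simp_all add: dist_word_map ratio_pos less_imp_le)
  then show ?thesis
    unfolding cyl_def using K_compact
    by (intro compact_continuous_image lipschitz_on_continuous_on)
qed

lemma dist_le_diameter_K: "x \<in> K \<Longrightarrow> y \<in> K \<Longrightarrow> dist x y \<le> diameter K"
  using K_compact by (intro diameter_bounded_bound) (auto simp: compact_imp_bounded)

lemma dist_cyl_le:
  assumes "set w \<subseteq> {1..n}" "x \<in> cyl w" "y \<in> cyl w"
  shows "dist x y \<le> ratio w * diameter K"
proof -
  obtain x' y' where "x' \<in> K" "y' \<in> K" "x = word_map \<phi> w x'" "y = word_map \<phi> w y'"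
    using assms by (auto simp: cyl_def)
  then show ?thesis
    using assms(1) ratio_pos[of w] dist_le_diameter_K by (simp add: dist_word_map mult_left_mono)
qed

text \<open>
  Finitely many pairs of disjoint compact sets, so the smallest of their distances is positive.
\<close>

lemma ex_gap:
  "\<exists>g>0. \<forall>i\<in>{1..n}. \<forall>j\<in>{1..n}. i \<noteq> j \<longrightarrow> (\<forall>x\<in>cyl [i]. \<forall>y\<in>cyl [j]. g \<le> dist x y)"
proof -
  have ex: "\<exists>d>0. \<forall>x\<in>cyl [i]. \<forall>y\<in>cyl [j]. d \<le> dist x y"
    if "i \<in> {1..n}" "j \<in> {1..n}" "i \<noteq> j" for i j
  proof (rule separate_compact_closed)
    show "compact (cyl [i])" "closed (cyl [j])"
      using that by (auto intro!: cyl_compact compact_imp_closed)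
    show "cyl [i] \<inter> cyl [j] = {}"
      using dust that by (auto simp: dust_like_ifs_def disjoint_family_on_def cyl_def)
  qed
  define P where "P = {p \<in> {1..n} \<times> {1..n}. fst p \<noteq> snd p}"
  have "\<forall>p\<in>P. \<exists>d>0. \<forall>x\<in>cyl [fst p]. \<forall>y\<in>cyl [snd p]. d \<le> dist x y"
    using ex by (auto simp: P_def)
  then obtain d where d: "\<forall>p\<in>P. d p > 0 \<and> (\<forall>x\<in>cyl [fst p]. \<forall>y\<in>cyl [snd p]. d p \<le> dist x y)"
    by metis
  have fin: "finite (insert 1 (d ` P))"
    by (simp add: P_def)
  show ?thesis
  proof (intro exI[of _ "Min (insert 1 (d ` P))"] conjI ballI impI)
    show "0 < Min (insert 1 (d ` P))"
      using d fin by (subst Min_gr_iff) auto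
    fix i j x y assume *: "i \<in> {1..n}" "j \<in> {1..n}" "i \<noteq> j" "x \<in> cyl [i]" "y \<in> cyl [j]"
    then have p: "(i, j) \<in> P"
      by (simp add: P_def)
    then have "Min (insert 1 (d ` P)) \<le> d (i, j)"
      using fin by (intro Min_le) auto
    also have "\<dots> \<le> dist x y"
      using d p * by fastforce
    finally show "Min (insert 1 (d ` P)) \<le> dist x y" .
  qed
qed

definition gap :: real where
  "gap = (SOME g. g > 0 \<and>
     (\<forall>i\<in>{1..n}. \<forall>j\<in>{1..n}. i \<noteq> j \<longrightarrow> (\<forall>x\<in>cyl [i]. \<forall>y\<in>cyl [j]. g \<le> dist x y)))"

lemma gap_pos: "0 < gap"
  and gap_le: "i \<in> {1..n} \<Longrightarrow> j \<in> {1..n} \<Longrightarrow> i \<noteq> j \<Longrightarrow> x \<in> cyl [i] \<Longrightarrow> y \<in> cyl [j] \<Longrightarrow> gap \<le> dist x y"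
  using someI_ex[OF ex_gap] unfolding gap_def by blast+

text \<open>
  This and \<open>dist_cyl_le\<close> turn the combinatorics of words into geometry: up to constants, the distance
  of two points is the ratio of the longest common prefix of their addresses.
\<close>

lemma branch_separation:
  assumes "set (u @ i # a) \<subseteq> {1..n}" "set (u @ j # b) \<subseteq> {1..n}" "i \<noteq> j"
    and "x \<in> cyl (u @ i # a)" "y \<in> cyl (u @ j # b)"
  shows "gap * ratio u \<le> dist x y"
proof -
  have "x \<in> cyl (u @ [i])" "y \<in> cyl (u @ [j])"
    using assms cyl_append_subset[of a "u @ [i]"] cyl_append_subset[of b "u @ [j]"] by auto
  then obtain x' y' where "x' \<in> cyl [i]" "x = word_map \<phi> u x'" "y' \<in> cyl [j]" "y = word_map \<phi> u y'"
    by (auto simp: cyl_append)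
  then show ?thesis
    using gap_le[of i j x' y'] assms ratio_pos[of u] by (simp add: dist_word_map)
qed

lemma cyl_separation:
  assumes "v \<in> words n k" "v' \<in> words n k" "v \<noteq> v'" "x \<in> cyl v" "y \<in> cyl v'"
  shows "gap * ratio v \<le> dist x y"
proof -
  have "length v = length v'"
    using assms by (simp add: words_def)
  from same_length_different[OF assms(3) this]
  obtain u i a j b where "v = u @ [i] @ a" "v' = u @ [j] @ b" and ij: "i \<noteq> j"
    by blast
  then have *: "v = u @ i # a" "v' = u @ j # b"
    by simp_all
  have sub: "set (u @ i # a) \<subseteq> {1..n}"
    using assms(1) unfolding * by (simp add: words_def)
  then have "ratio v \<le> ratio u"
    using ratio_pos[of u] ratio_le_1[of "i # a"] mult_left_le[of "ratio (i # a)" "ratio u"]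
    unfolding * ratio_append by (auto simp del: ratio_Cons)
  then have "gap * ratio v \<le> gap * ratio u"
    using gap_pos by simp
  also have "\<dots> \<le> dist x y"
    using assms ij unfolding * by (intro branch_separation[of u i a j b]) (auto simp: words_def)
  finally show ?thesis .
qed

lemma cyl_disjoint:
  assumes "v \<in> words n k" "v' \<in> words n k" "v \<noteq> v'"
  shows "cyl v \<inter> cyl v' = {}"
proof -
  have "0 < gap * ratio v"
    using assms gap_pos ratio_pos[of v] by (auto simp: words_def)
  then show ?thesis
    using cyl_separation[OF assms] by fastforce
qed

text \<open>
  A cylinder is isolated in \<open>K\<close> at the scale of its own diameter. It is through this fact that a
  Lipschitz map into a dust-like set must map sufficiently small cylinders into a single cylinder.
\<close>

lemma complement_separation:
  assumes "set v \<subseteq> {1..n}" "x \<in> cyl v" "y \<in> K" "y \<notin> cyl v"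
  shows "gap * ratio v \<le> dist x y"
proof -
  obtain v' where "v' \<in> words n (length v)" "y \<in> cyl v'"
    using assms(3) K_eq_words[of "length v"] by auto
  with assms show ?thesis
    by (intro cyl_separation[of v "length v" v']) (auto simp: words_def)
qed

end

section \<open>Hausdorff measure and the similarity dimension\<close>

lemma diam_pow_nonneg: "0 \<le> diam_pow s U"
  by (simp add: diam_pow_def)

context dust_ifs
begin

text \<open>
  By the Moran equation, the value \<open>\<sigma>\<close> at which \<open>pressure\<close> equals \<open>1\<close> is the similarity dimension. For
  that \<open>\<sigma>\<close>, \<open>weight \<sigma> w\<close> is the measure of the cylinder of \<open>w\<close> under the natural probability measure,
  and \<open>mass \<sigma> E k\<close> is the measure of the \<open>k\<close>-th generation neighbourhood of \<open>E\<close>.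
\<close>

definition pressure :: "real \<Rightarrow> real" where
  "pressure \<sigma> = (\<Sum>i\<in>{1..n}. r i powr \<sigma>)"

definition weight :: "real \<Rightarrow> nat list \<Rightarrow> real" where
  "weight \<sigma> w = prod_list (map (\<lambda>i. r i powr \<sigma>) w)"

definition hits :: "'a set \<Rightarrow> nat \<Rightarrow> nat list set" where
  "hits E k = {v \<in> words n k. cyl v \<inter> E \<noteq> {}}"

definition mass :: "real \<Rightarrow> 'a set \<Rightarrow> nat \<Rightarrow> real" where
  "mass \<sigma> E k = (\<Sum>v\<in>hits E k. weight \<sigma> v)"

lemma weight_Nil [simp]: "weight \<sigma> [] = 1"
  and weight_append [simp]: "weight \<sigma> (u @ v) = weight \<sigma> u * weight \<sigma> v"
  and weight_Cons [simp]: "weight \<sigma> (i # v) = r i powr \<sigma> * weight \<sigma> v"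
  by (simp_all add: weight_def)

lemma weight_eq: "set w \<subseteq> {1..n} \<Longrightarrow> weight \<sigma> w = ratio w powr \<sigma>"
proof (induction w)
  case (Cons i w)
  then show ?case
    using r_bounds(1)[of i] ratio_pos[of w] by (simp add: powr_mult)
qed simp

lemma weight_pos: "set w \<subseteq> {1..n} \<Longrightarrow> 0 < weight \<sigma> w"
  using ratio_pos[of w] by (simp add: weight_eq)

lemma weight_nonneg [simp]: "0 \<le> weight \<sigma> w"
  by (induction w) auto

lemma sum_weight: "(\<Sum>w\<in>words n k. weight \<sigma> w) = pressure \<sigma> ^ k"
  unfolding weight_def pressure_def by (rule sum_words_prod_list)

lemma finite_hits [simp]: "finite (hits E k)"
  by (simp add: hits_def)

lemma diameter_K_nonneg: "0 \<le> diameter K"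
  using K_compact by (simp add: diameter_ge_0 compact_imp_bounded)

lemma small_cylinders:
  assumes "0 < \<delta>"
  shows "\<exists>k0. \<forall>k\<ge>k0. \<forall>v\<in>words n k. ratio v < \<delta>"
proof -
  define q where "q = Max (r ` {1..n})"
  have ne: "r ` {1..n} \<noteq> {}"
    using two_le_n by auto
  have "q \<in> r ` {1..n}"
    unfolding q_def using ne by (intro Max_in) auto
  then have q: "0 < q" "q < 1"
    using r_bounds by auto
  have r_le: "r i \<le> q" if "i \<in> {1..n}" for i
    unfolding q_def using that by (intro Max_ge) auto
  have bound: "ratio v \<le> q ^ length v" if "set v \<subseteq> {1..n}" for v
    using that
  proof (induction v)
    case (Cons i v)
    then show ?case
      using r_le[of i] r_bounds(1)[of i] ratio_pos[of v] q by (auto intro!: mult_mono)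
  qed simp
  obtain k0 where k0: "q ^ k0 < \<delta>"
    using real_arch_pow_inv[OF assms q(2)] by auto
  show ?thesis
  proof (intro exI[of _ k0] allI impI ballI)
    fix k v assume "k0 \<le> k" and v: "v \<in> words n k"
    then have "q ^ k \<le> q ^ k0"
      using q by (intro power_decreasing) auto
    then show "ratio v < \<delta>"
      using bound[of v] v k0 by (auto simp: words_def)
  qed
qed

lemma diameter_cyl_le: "set v \<subseteq> {1..n} \<Longrightarrow> diameter (cyl v) \<le> ratio v * diameter K"
proof -
  assume v: "set v \<subseteq> {1..n}"
  have "diameter (cyl v) = (SUP p\<in>cyl v \<times> cyl v. dist (fst p) (snd p))"
    using cyl_nonempty by (simp add: diameter_def case_prod_beta)
  also have "\<dots> \<le> ratio v * diameter K"
    using dist_cyl_le[OF v] cyl_nonempty[of v] by (intro cSUP_least) auto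
  finally show ?thesis .
qed

lemma diam_pow_cyl_le:
  assumes "0 < \<sigma>" "set v \<subseteq> {1..n}"
  shows "diam_pow \<sigma> (cyl v) \<le> diameter K powr \<sigma> * weight \<sigma> v"
proof -
  have "0 \<le> diameter (cyl v)"
    using cyl_compact[OF assms(2)] by (simp add: diameter_ge_0 compact_imp_bounded)
  then have "diameter (cyl v) powr \<sigma> \<le> (ratio v * diameter K) powr \<sigma>"
    using assms by (intro powr_mono2 diameter_cyl_le) auto
  also have "\<dots> = diameter K powr \<sigma> * weight \<sigma> v"
    using ratio_pos[OF assms(2)] diameter_K_nonneg by (simp add: powr_mult weight_eq[OF assms(2)])
  finally show ?thesis
    using assms(1) cyl_nonempty by (simp add: diam_pow_def)
qed

text \<open>
  The cylinders of generation \<open>k\<close> that meet \<open>E\<close> are a cover; the sequence of covering sets is filled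
  up with empty sets, which have weight \<open>0\<close>.
\<close>

lemma hausdorff_content_le_mass:
  assumes "0 < \<sigma>" "0 < \<delta>" "E \<subseteq> K" "\<And>v. v \<in> words n k \<Longrightarrow> ratio v * diameter K \<le> \<delta>"
  shows "hausdorff_content \<delta> \<sigma> E \<le> ennreal (diameter K powr \<sigma> * mass \<sigma> E k)"
proof -
  define N where "N = card (hits E k)"
  obtain h where h: "bij_betw h {..<N} (hits E k)"
    using ex_bij_betw_nat_finite[OF finite_hits[of E k]] unfolding N_def lessThan_atLeast0 by blast
  define U where "U i = (if i < N then cyl (h i) else {})" for i
  have hw: "h i \<in> words n k" if "i < N" for i
    using h that by (auto simp: bij_betw_def hits_def)
  have "E \<subseteq> (\<Union>i. U i)"
  proof
    fix x assume x: "x \<in> E"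
    then obtain v where "v \<in> words n k" "x \<in> cyl v"
      using assms(3) ex_word_cyl by blast
    with x have "v \<in> hits E k"
      by (auto simp: hits_def)
    then have "v \<in> h ` {..<N}"
      using h by (simp add: bij_betw_def)
    then obtain i where "i < N" "h i = v"
      by blast
    with \<open>x \<in> cyl v\<close> show "x \<in> (\<Union>i. U i)"
      by (auto simp: U_def intro!: exI[of _ i])
  qed
  moreover have "bounded (U i) \<and> diameter (U i) \<le> \<delta>" for i
  proof (cases "i < N")
    case True
    then have v: "set (h i) \<subseteq> {1..n}"
      using hw by (simp add: words_def)
    show ?thesis
      using True cyl_compact[OF v] diameter_cyl_le[OF v] assms(4)[OF hw[OF True]]
      by (simp add: U_def compact_imp_bounded)
  qed (use assms(2) in \<open>simp add: U_def\<close>)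
  ultimately have "hausdorff_content \<delta> \<sigma> E \<le> (\<Sum>i. ennreal (diam_pow \<sigma> (U i)))"
    unfolding hausdorff_content_def by (intro INF_lower) auto
  also have "\<dots> = (\<Sum>i<N. ennreal (diam_pow \<sigma> (U i)))"
    by (rule suminf_finite) (auto simp: U_def diam_pow_def)
  also have "\<dots> = ennreal (\<Sum>i<N. diam_pow \<sigma> (U i))"
    by (simp add: diam_pow_nonneg)
  also have "(\<Sum>i<N. diam_pow \<sigma> (U i)) \<le> (\<Sum>i<N. diameter K powr \<sigma> * weight \<sigma> (h i))"
    using diam_pow_cyl_le[OF assms(1) wordsD[OF hw]] by (intro sum_mono) (simp add: U_def)
  also have "\<dots> = diameter K powr \<sigma> * mass \<sigma> E k"
    unfolding mass_def sum_distrib_left by (rule sum.reindex_bij_betw[OF h])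
  finally show ?thesis
    by (auto simp: ennreal_leI)
qed

lemma eventually_small:
  assumes "0 < \<delta>"
  shows "\<exists>k0. \<forall>k\<ge>k0. \<forall>v\<in>words n k. ratio v * diameter K \<le> \<delta>"
proof -
  have D: "0 < diameter K + 1"
    using diameter_K_nonneg by simp
  then obtain k0 where k0: "\<forall>k\<ge>k0. \<forall>v\<in>words n k. ratio v < \<delta> / (diameter K + 1)"
    using small_cylinders[of "\<delta> / (diameter K + 1)"] assms by auto
  show ?thesis
  proof (intro exI[of _ k0] allI impI ballI)
    fix k v assume *: "k0 \<le> k" "v \<in> words n k"
    then have "ratio v * diameter K \<le> ratio v * (diameter K + 1)"
      using ratio_pos[of v] by (simp add: words_def algebra_simps)
    also have "\<dots> \<le> \<delta>"
      using k0 * D by (auto simp: field_simps less_imp_le)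
    finally show "ratio v * diameter K \<le> \<delta>" .
  qed
qed

lemma mass_le_pressure_power: "mass \<sigma> E k \<le> pressure \<sigma> ^ k"
  unfolding mass_def sum_weight[symmetric]
  by (rule sum_mono2) (auto simp: hits_def)

lemma mass_nonneg: "0 \<le> mass \<sigma> E k"
  unfolding mass_def by (intro sum_nonneg weight_nonneg)

lemma hits_snoc: "v @ [i] \<in> hits E (Suc k) \<Longrightarrow> v \<in> hits E k"
  using cyl_append_subset[of "[i]" v] by (auto simp: hits_def words_def)

lemma hausdorff_measure_null:
  assumes "0 < \<sigma>" "pressure \<sigma> < 1"
  shows "hausdorff_measure \<sigma> K = 0"
proof -
  have "hausdorff_content \<delta> \<sigma> K \<le> 0" if \<delta>: "0 < \<delta>" for \<delta>
  proof -
    obtain k0 where k0: "\<forall>k\<ge>k0. \<forall>v\<in>words n k. ratio v * diameter K \<le> \<delta>"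
      using eventually_small[OF \<delta>] by auto
    have "0 \<le> pressure \<sigma>"
      by (simp add: pressure_def sum_nonneg)
    then have "(\<lambda>k. ennreal (diameter K powr \<sigma> * pressure \<sigma> ^ k)) \<longlonglongrightarrow> ennreal (diameter K powr \<sigma> * 0)"
      using assms by (intro tendsto_ennrealI tendsto_mult tendsto_const LIMSEQ_realpow_zero) auto
    moreover have "hausdorff_content \<delta> \<sigma> K \<le> ennreal (diameter K powr \<sigma> * pressure \<sigma> ^ k)" if "k \<ge> k0" for k
    proof -
      have "hausdorff_content \<delta> \<sigma> K \<le> ennreal (diameter K powr \<sigma> * mass \<sigma> K k)"
        using k0 \<open>k \<ge> k0\<close> by (intro hausdorff_content_le_mass assms \<delta>) auto
      also have "\<dots> \<le> ennreal (diameter K powr \<sigma> * pressure \<sigma> ^ k)"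
        by (intro ennreal_leI mult_left_mono mass_le_pressure_power) simp
      finally show ?thesis .
    qed
    ultimately have "hausdorff_content \<delta> \<sigma> K \<le> ennreal (diameter K powr \<sigma> * 0)"
      by (intro LIMSEQ_le_const) auto
    then show ?thesis by simp
  qed
  then show ?thesis
    unfolding hausdorff_measure_def by (auto intro!: SUP_eq_const)
qed

lemma mass_antimono:
  assumes "pressure \<sigma> \<le> 1" shows "antimono (mass \<sigma> E)"
proof (rule decseq_SucI)
  fix k
  have sub: "hits E (Suc k) \<subseteq> (\<lambda>(v, i). v @ [i]) ` (hits E k \<times> {1..n})"
  proof
    fix w assume w: "w \<in> hits E (Suc k)"
    then obtain v i where "w = v @ [i]"
      by (cases w rule: rev_cases) (auto simp: hits_def words_def)
    with w hits_snoc[of v i E k] show "w \<in> (\<lambda>(v, i). v @ [i]) ` (hits E k \<times> {1..n})"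
      by (auto simp: hits_def words_def)
  qed
  have "mass \<sigma> E (Suc k) \<le> (\<Sum>w\<in>(\<lambda>(v, i). v @ [i]) ` (hits E k \<times> {1..n}). weight \<sigma> w)"
    unfolding mass_def using sub
    by (intro sum_mono2 finite_imageI finite_cartesian_product weight_nonneg) simp_all
  also have "\<dots> = (\<Sum>(v, i)\<in>hits E k \<times> {1..n}. weight \<sigma> v * r i powr \<sigma>)"
    by (subst sum.reindex) (auto simp: inj_on_def case_prod_beta)
  also have "\<dots> = mass \<sigma> E k * pressure \<sigma>"
    by (simp add: mass_def pressure_def sum_product sum.cartesian_product)
  also have "\<dots> \<le> mass \<sigma> E k"
    using assms mass_nonneg by (simp add: mult_left_le)
  finally show "mass \<sigma> E (Suc k) \<le> mass \<sigma> E k" .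
qed

text \<open>
  The bound uses a single generation \<open>k\<close> although \<open>\<delta>\<close> tends to \<open>0\<close>: finer covers are provided by later
  generations, whose mass is not larger.
\<close>

lemma hausdorff_measure_le_mass:
  assumes "0 < \<sigma>" "pressure \<sigma> \<le> 1" "E \<subseteq> K"
  shows "hausdorff_measure \<sigma> E \<le> ennreal (diameter K powr \<sigma> * mass \<sigma> E k)"
  unfolding hausdorff_measure_def
proof (rule SUP_least)
  fix \<delta> :: real assume "\<delta> \<in> {0<..}"
  then have \<delta>: "0 < \<delta>" by simp
  obtain k0 where k0: "\<forall>k\<ge>k0. \<forall>v\<in>words n k. ratio v * diameter K \<le> \<delta>"
    using eventually_small[OF \<delta>] by auto
  have "hausdorff_content \<delta> \<sigma> E \<le> ennreal (diameter K powr \<sigma> * mass \<sigma> E (max k k0))"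
    using k0[rule_format, OF max.cobounded2] by (intro hausdorff_content_le_mass assms \<delta>) simp
  also have "\<dots> \<le> ennreal (diameter K powr \<sigma> * mass \<sigma> E k)"
    using antimonoD[OF mass_antimono[OF assms(2)] max.cobounded1]
    by (intro ennreal_leI mult_left_mono) simp_all
  finally show "hausdorff_content \<delta> \<sigma> E \<le> ennreal (diameter K powr \<sigma> * mass \<sigma> E k)" .
qed

lemma closed_complement_cyl:
  assumes "set v \<subseteq> {1..n}" shows "closed (K - cyl v)"
proof -
  have "K - cyl v = (\<Union>w\<in>words n (length v) - {v}. cyl w)"
  proof (intro equalityI subsetI)
    fix x assume "x \<in> K - cyl v"
    then show "x \<in> (\<Union>w\<in>words n (length v) - {v}. cyl w)"
      using ex_word_cyl[of x "length v"] by blast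
  next
    fix x assume "x \<in> (\<Union>w\<in>words n (length v) - {v}. cyl w)"
    then obtain w where w: "w \<in> words n (length v)" "w \<noteq> v" "x \<in> cyl w"
      by blast
    moreover have "v \<in> words n (length v)"
      using assms by (simp add: words_def)
    ultimately show "x \<in> K - cyl v"
      using cyl_disjoint[of w "length v" v] cyl_subset[OF wordsD[OF w(1)]] by blast
  qed
  also have "closed \<dots>"
    by (intro closed_UN ballI compact_imp_closed cyl_compact) (auto dest!: wordsD)
  finally show ?thesis .
qed

text \<open>
  The mass distribution principle for covers by cylinders, in combinatorial form. Descend from each
  covering cylinder to a common generation \<open>k\<close>: the words so reached include all words of length \<open>k\<close>,
  whose total weight is \<open>pressure \<sigma> ^ k\<close>.
\<close>

lemma cylinder_cover_weight:
  assumes fin: "finite A" and v: "\<And>i. i \<in> A \<Longrightarrow> set (v i) \<subseteq> {1..n}"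
    and cover: "K \<subseteq> (\<Union>i\<in>A. cyl (v i))" and p: "1 \<le> pressure \<sigma>"
  shows "1 \<le> (\<Sum>i\<in>A. weight \<sigma> (v i))"
proof -
  define k where "k = Max ((length \<circ> v) ` A)"
  have le_k: "length (v i) \<le> k" if "i \<in> A" for i
    unfolding k_def using that fin by (intro Max_ge) auto
  have "pressure \<sigma> ^ k = (\<Sum>w\<in>words n k. weight \<sigma> w)"
    by (rule sum_weight[symmetric])
  also have "\<dots> \<le> (\<Sum>(i, u)\<in>(SIGMA i:A. words n (k - length (v i))). weight \<sigma> (v i @ u))"
  proof (rule sum_le_included[where i = "\<lambda>(i, u). v i @ u"])
    show "\<forall>w\<in>words n k. \<exists>y\<in>SIGMA i:A. words n (k - length (v i)).
        (case y of (i, u) \<Rightarrow> v i @ u) = w \<and> weight \<sigma> w \<le> (case y of (i, u) \<Rightarrow> weight \<sigma> (v i @ u))"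
    proof
      fix w assume w: "w \<in> words n k"
      obtain x where x: "x \<in> cyl w"
        using cyl_nonempty by blast
      then have "x \<in> K"
        using cyl_subset[OF wordsD[OF w]] by blast
      then obtain i where i: "i \<in> A" "x \<in> cyl (v i)"
        using cover by auto
      then obtain u where u: "u \<in> words n (k - length (v i))" "x \<in> cyl (v i @ u)"
        using cyl_extend[of "v i" "k - length (v i)"] by auto
      then have "v i @ u \<in> words n k"
        using v[OF i(1)] le_k[OF i(1)] by (auto simp: words_def)
      then have "v i @ u = w"
        using cyl_disjoint w x u by blast
      then show "\<exists>y\<in>SIGMA i:A. words n (k - length (v i)).
          (case y of (i, u) \<Rightarrow> v i @ u) = w \<and> weight \<sigma> w \<le> (case y of (i, u) \<Rightarrow> weight \<sigma> (v i @ u))"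
        using i u by (intro bexI[of _ "(i, u)"]) auto
    qed
    show "\<forall>y\<in>SIGMA i:A. words n (k - length (v i)). 0 \<le> (case y of (i, u) \<Rightarrow> weight \<sigma> (v i @ u))"
      by (auto simp del: weight_append)
  qed (use fin in auto)
  also have "\<dots> = (\<Sum>i\<in>A. weight \<sigma> (v i) * pressure \<sigma> ^ (k - length (v i)))"
    using fin by (subst sum.Sigma[symmetric]) (auto simp: sum_distrib_left[symmetric] sum_weight)
  also have "\<dots> \<le> (\<Sum>i\<in>A. weight \<sigma> (v i) * pressure \<sigma> ^ k)"
    using p by (intro sum_mono mult_left_mono power_increasing) auto
  finally have "pressure \<sigma> ^ k * 1 \<le> pressure \<sigma> ^ k * (\<Sum>i\<in>A. weight \<sigma> (v i))"
    by (simp add: sum_distrib_left mult.commute)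
  moreover have "0 < pressure \<sigma> ^ k"
    using p by simp
  ultimately show ?thesis
    by (simp only: mult_le_cancel_left_pos)
qed

text \<open>
  Reduces arbitrary covers to covers by cylinders. The smallest cylinder containing \<open>U \<inter> K\<close> has
  two children meeting \<open>U\<close>, so \<open>U\<close> stretches across one of its gaps. The error \<open>\<epsilon>\<close> is for sets with at
  most one point in \<open>K\<close>, which lie in arbitrarily small cylinders.
\<close>

lemma enclosing_cylinder:
  assumes "0 < \<sigma>" "0 < \<epsilon>" "bounded U"
  shows "\<exists>v. set v \<subseteq> {1..n} \<and> U \<inter> K \<subseteq> cyl v \<and> gap powr \<sigma> * weight \<sigma> v \<le> diam_pow \<sigma> U + \<epsilon>"
proof (cases "\<exists>x\<in>U \<inter> K. \<exists>y\<in>U \<inter> K. x \<noteq> y")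
  case True
  then obtain x y where xy: "x \<in> U \<inter> K" "y \<in> U \<inter> K" "x \<noteq> y"
    by blast
  obtain k0 where k0: "\<forall>k\<ge>k0. \<forall>v\<in>words n k. ratio v * diameter K \<le> dist x y / 2"
    using eventually_small[of "dist x y / 2"] xy by auto
  define P where "P k \<longleftrightarrow> (\<exists>v\<in>words n k. U \<inter> K \<subseteq> cyl v)" for k
  have P0: "P 0"
    by (auto simp: P_def)
  have bdd: "\<forall>k. P k \<longrightarrow> k \<le> k0"
  proof (intro allI impI)
    fix k assume Pk: "P k"
    show "k \<le> k0"
  proof (rule ccontr)
    assume "\<not> k \<le> k0"
    obtain v where v: "v \<in> words n k" "U \<inter> K \<subseteq> cyl v"
      using Pk unfolding P_def by blast
    then have "dist x y \<le> ratio v * diameter K"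
      using xy by (intro dist_cyl_le wordsD[OF v(1)]) blast+
    also have "\<dots> \<le> dist x y / 2"
      using k0 v(1) \<open>\<not> k \<le> k0\<close> by (meson nat_le_linear)
    finally show False
      using xy by simp
    qed
  qed
  have "\<exists>k. P k \<and> \<not> P (Suc k)"
  proof (rule ccontr)
    assume "\<not> ?thesis"
    then have "P k" for k
      using P0 by (induction k) auto
    then show False
      using bdd Suc_n_not_le_n by blast
  qed
  then obtain k where k: "P k" "\<not> P (Suc k)"
    by blast
  then obtain v where v: "v \<in> words n k" "U \<inter> K \<subseteq> cyl v"
    by (auto simp: P_def)
  then obtain i where i: "i \<in> {1..n}" "x \<in> cyl (v @ [i])"
    using cyl_snoc[of v] xy(1) by blast
  have "v @ [i] \<in> words n (Suc k)"
    using v i by (auto simp: words_def)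
  then obtain z where z: "z \<in> U \<inter> K" "z \<notin> cyl (v @ [i])"
    using k by (auto simp: P_def)
  then obtain j where j: "j \<in> {1..n}" "z \<in> cyl (v @ [j])"
    using cyl_snoc[of v] v by blast
  then have "gap * ratio v \<le> dist x z"
    using v i z by (intro branch_separation[of v i "[]" j "[]"]) (auto simp: words_def)
  also have "\<dots> \<le> diameter U"
    using assms xy z by (intro diameter_bounded_bound) auto
  finally have "(gap * ratio v) powr \<sigma> \<le> diameter U powr \<sigma>"
    using assms v gap_pos ratio_pos[of v] by (intro powr_mono2) (auto simp: words_def)
  then have "gap powr \<sigma> * weight \<sigma> v \<le> diam_pow \<sigma> U + \<epsilon>"
    using v assms xy gap_pos ratio_pos[of v] by (auto simp: diam_pow_def words_def weight_eq powr_mult)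
  with v show ?thesis
    by (auto simp: words_def)
next
  case False
  define \<delta> where "\<delta> = (\<epsilon> / gap powr \<sigma>) powr (1 / \<sigma>)"
  have "0 < \<delta>"
    using assms gap_pos by (simp add: \<delta>_def)
  then obtain k where k: "\<forall>v\<in>words n k. ratio v < \<delta>"
    using small_cylinders[of \<delta>] by (meson order_refl)
  have small: "gap powr \<sigma> * weight \<sigma> v \<le> \<epsilon>" if "v \<in> words n k" for v
  proof -
    have "weight \<sigma> v \<le> \<delta> powr \<sigma>"
      unfolding weight_eq[OF wordsD[OF that]] using k that assms(1) ratio_pos[OF wordsD[OF that]]
      by (intro powr_mono2) (simp_all add: less_imp_le)
    also have "\<dots> = \<epsilon> / gap powr \<sigma>"
      using assms gap_pos by (simp add: \<delta>_def powr_powr)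
    finally show ?thesis
      using gap_pos by (simp add: field_simps)
  qed
  obtain v where v: "v \<in> words n k" "U \<inter> K \<subseteq> cyl v"
  proof (cases "U \<inter> K = {}")
    case True
    moreover obtain v where "v \<in> words n k"
      using K_nonempty ex_word_cyl[of _ k] by auto
    ultimately show ?thesis
      using that by auto
  next
    case nonempty: False
    then obtain x where x: "x \<in> U \<inter> K" by blast
    have "U \<inter> K \<subseteq> {x}"
      using x False by auto
    moreover obtain v where "v \<in> words n k" "x \<in> cyl v"
      using ex_word_cyl[of x k] x by auto
    ultimately show ?thesis
      using that[of v] by auto
  qed
  show ?thesis
    using small[OF v(1)] diam_pow_nonneg[of \<sigma> U] v(2) wordsD[OF v(1)]
    by (intro exI[of _ v] conjI) simp_all
qed

text \<open>
  Every cover is replaced by a cover of comparable weight by cylinders. These are relatively open in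
  \<open>K\<close>, so finitely many of them suffice and \<open>cylinder_cover_weight\<close> applies. For \<open>\<sigma> = 0\<close> the claim holds
  because any non-empty set has weight \<open>1\<close>.
\<close>

lemma hausdorff_measure_pos:
  assumes "0 \<le> \<sigma>" "1 \<le> pressure \<sigma>"
  shows "hausdorff_measure \<sigma> K \<noteq> 0"
proof -
  define c where "c = (if \<sigma> = 0 then 1 else gap powr \<sigma> / 2)"
  have c: "0 < c"
    using gap_pos by (simp add: c_def)
  have "ennreal c \<le> hausdorff_content 1 \<sigma> K"
    unfolding hausdorff_content_def
  proof (rule INF_greatest)
    fix U :: "nat \<Rightarrow> 'a set"
    assume "U \<in> {U. K \<subseteq> (\<Union>i. U i) \<and> (\<forall>i. bounded (U i) \<and> diameter (U i) \<le> 1)}"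
    then have U: "K \<subseteq> (\<Union>i. U i)" "\<And>i. bounded (U i)"
      by auto
    have part: "(\<Sum>i\<in>A. ennreal (diam_pow \<sigma> (U i))) \<le> (\<Sum>i. ennreal (diam_pow \<sigma> (U i)))" if "finite A" for A
      using that by (intro sum_le_suminf) auto
    show "ennreal c \<le> (\<Sum>i. ennreal (diam_pow \<sigma> (U i)))"
    proof (cases "\<sigma> = 0")
      case True
      obtain i where "U i \<noteq> {}"
        using U(1) K_nonempty by fastforce
      then have "diam_pow \<sigma> (U i) = c"
        using True by (simp add: diam_pow_def c_def)
      then show ?thesis
        using part[of "{i}"] by simp
    next
      case False
      define e where "e i = c * (1 / 2) ^ Suc i" for i
      have e: "0 < e i" for i
        using c by (simp add: e_def)
      have "\<exists>v. \<forall>i. set (v i) \<subseteq> {1..n} \<and> U i \<inter> K \<subseteq> cyl (v i) \<and>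
          gap powr \<sigma> * weight \<sigma> (v i) \<le> diam_pow \<sigma> (U i) + e i"
        using enclosing_cylinder[OF _ e U(2)] False assms by (intro choice) auto
      then obtain v where v: "\<And>i. set (v i) \<subseteq> {1..n}" "\<And>i. U i \<inter> K \<subseteq> cyl (v i)"
          "\<And>i. gap powr \<sigma> * weight \<sigma> (v i) \<le> diam_pow \<sigma> (U i) + e i"
        by blast
      have op: "open (- (K - cyl (v i)))" for i
        by (intro open_Compl closed_complement_cyl v(1))
      have cov: "K \<subseteq> (\<Union>i\<in>UNIV. - (K - cyl (v i)))"
        using U(1) v(2) by blast
      obtain A where A: "finite A" "K \<subseteq> (\<Union>i\<in>A. - (K - cyl (v i)))"
        using compactE_image[OF K_compact op cov] by metis
      have "1 \<le> (\<Sum>i\<in>A. weight \<sigma> (v i))"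
      proof (rule cylinder_cover_weight[OF A(1) v(1) _ assms(2)])
        show "K \<subseteq> (\<Union>i\<in>A. cyl (v i))"
          using A(2) by blast
      qed
      then have "gap powr \<sigma> * 1 \<le> gap powr \<sigma> * (\<Sum>i\<in>A. weight \<sigma> (v i))"
        by (rule mult_left_mono) simp
      also have "\<dots> = (\<Sum>i\<in>A. gap powr \<sigma> * weight \<sigma> (v i))"
        by (rule sum_distrib_left)
      also have "\<dots> \<le> (\<Sum>i\<in>A. diam_pow \<sigma> (U i) + e i)"
        by (intro sum_mono v(3))
      also have "\<dots> = (\<Sum>i\<in>A. diam_pow \<sigma> (U i)) + (\<Sum>i\<in>A. e i)"
        by (rule sum.distrib)
      also have "(\<Sum>i\<in>A. e i) \<le> c"
      proof -
        have "e sums (c * 1)"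
          unfolding e_def by (intro sums_mult power_half_series)
        then show ?thesis
          using A(1) e sum_le_suminf[of e A] by (auto simp: sums_iff less_imp_le)
      qed
      finally have "c \<le> (\<Sum>i\<in>A. diam_pow \<sigma> (U i))"
        using False by (simp add: c_def)
      then have "ennreal c \<le> (\<Sum>i\<in>A. ennreal (diam_pow \<sigma> (U i)))"
        by (simp add: diam_pow_nonneg ennreal_leI)
      also have "\<dots> \<le> (\<Sum>i. ennreal (diam_pow \<sigma> (U i)))"
        by (rule part[OF A(1)])
      finally show ?thesis .
    qed
  qed
  also have "\<dots> \<le> hausdorff_measure \<sigma> K"
    unfolding hausdorff_measure_def by (rule SUP_upper) simp
  finally show ?thesis
    using c by (auto simp: ennreal_eq_0_iff)
qed

lemma pressure_0: "pressure 0 = n"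
proof -
  have "pressure 0 = (\<Sum>i\<in>{1..n}. 1)"
    unfolding pressure_def by (intro sum.cong refl) (use r_bounds(1) in force)
  then show ?thesis by simp
qed

lemma pressure_antimono: "\<sigma> \<le> \<tau> \<Longrightarrow> pressure \<tau> \<le> pressure \<sigma>"
  unfolding pressure_def using r_bounds by (intro sum_mono powr_mono') (auto simp: less_imp_le)

lemma continuous_pressure: "isCont pressure \<sigma>"
  unfolding pressure_def by (intro continuous_intros) (use r_bounds(1) in force)

lemma hausdorff_measure_eq_0_iff:
  assumes "0 \<le> \<sigma>"
  shows "hausdorff_measure \<sigma> K = 0 \<longleftrightarrow> pressure \<sigma> < 1"
proof
  assume *: "pressure \<sigma> < 1"
  then have "\<sigma> \<noteq> 0"
    using pressure_0 two_le_n by auto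
  then show "hausdorff_measure \<sigma> K = 0"
    using assms * by (intro hausdorff_measure_null) auto
qed (use hausdorff_measure_pos[OF assms] in force)

text \<open>
  The exponents of measure zero are exactly those of pressure below \<open>1\<close>. As the pressure is continuous
  and decreasing, it equals \<open>1\<close> at their infimum; and \<open>0 < s\<close> since the pressure at \<open>0\<close> is \<open>n \<ge> 2\<close>.
\<close>

lemma hausdorff_dim_pressure:
  assumes "hausdorff_dim K = ereal s"
  shows "0 < s" "pressure s = 1"
proof -
  define Z where "Z = {\<sigma>. 0 \<le> \<sigma> \<and> pressure \<sigma> < 1}"
  have "{\<sigma>. 0 \<le> \<sigma> \<and> hausdorff_measure \<sigma> K = 0} = Z"
    using hausdorff_measure_eq_0_iff by (auto simp: Z_def)
  then have dim: "ereal s = (INF \<sigma>\<in>Z. ereal \<sigma>)"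
    using assms by (simp add: hausdorff_dim_def)
  have "ereal 0 \<le> ereal s"
    unfolding dim by (rule INF_greatest) (simp add: Z_def)
  then have s0: "0 \<le> s" by simp
  have le: "s \<le> \<sigma>" if "\<sigma> \<in> Z" for \<sigma>
    using INF_lower[OF that, of ereal] unfolding dim[symmetric] by simp
  have lim: "(pressure \<longlongrightarrow> pressure s) (at s)"
    using continuous_pressure[of s] by (simp add: isCont_def)
  have ge: "1 \<le> pressure s"
  proof (rule ccontr)
    assume "\<not> 1 \<le> pressure s"
    then have lt: "pressure s < 1" by simp
    then have "s \<noteq> 0"
      using pressure_0 two_le_n by auto
    with s0 have pos: "0 < s" by simp
    have "eventually (\<lambda>\<sigma>. pressure \<sigma> < 1) (at_left s)"
      using order_tendstoD(2)[OF lim lt] by (simp add: eventually_at_split)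
    moreover have "eventually (\<lambda>\<sigma>. \<sigma> \<in> {0<..<s}) (at_left s)"
      by (rule eventually_at_leftI[OF _ pos]) auto
    ultimately have "eventually (\<lambda>\<sigma>. False) (at_left s)"
    proof eventually_elim
      case (elim \<sigma>)
      then show ?case
        using le[of \<sigma>] by (simp add: Z_def)
    qed
    then show False by simp
  qed
  moreover have "pressure s \<le> 1"
  proof (rule ccontr)
    assume "\<not> pressure s \<le> 1"
    then have "1 < pressure s" by simp
    then have "eventually (\<lambda>\<sigma>. 1 < pressure \<sigma>) (at_right s)"
      using order_tendstoD(1)[OF lim] by (simp add: eventually_at_split)
    then obtain b where b: "b > s" "\<forall>y>s. y < b \<longrightarrow> 1 < pressure y"
      by (auto simp: eventually_at_right_field)
    define m where "m = (s + b) / 2"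
    have m: "s < m" "m < b"
      using b(1) by (auto simp: m_def)
    have "m \<le> \<sigma>" if "\<sigma> \<in> Z" for \<sigma>
    proof (rule ccontr)
      assume "\<not> m \<le> \<sigma>"
      then have "pressure m \<le> pressure \<sigma>"
        by (intro pressure_antimono) simp
      then show False
        using that b(2) m by (auto simp: Z_def)
    qed
    then have "ereal m \<le> ereal s"
      unfolding dim by (intro INF_greatest) auto
    then show False
      using m by simp
  qed
  ultimately show "pressure s = 1" by simp
  then show "0 < s"
    using s0 pressure_0 two_le_n by (cases "s = 0") auto
qed

end

section \<open>Counting cylinders in preimages\<close>

text \<open>
  Here \<open>q\<close> is the common ratio of the homogeneous set \<open>K\<close>, and \<open>s\<close> the common dimension.
\<close>

locale lipschitz_pair =
  K: dust_ifs n r \<phi> K + F: dust_ifs m t \<psi> F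
  for n r and \<phi> :: "nat \<Rightarrow> 'a::heine_borel \<Rightarrow> 'a" and K
    and m t and \<psi> :: "nat \<Rightarrow> 'b::heine_borel \<Rightarrow> 'b" and F +
  fixes f :: "'a \<Rightarrow> 'b" and L q s :: real
  assumes lip: "L-lipschitz_on K f" and image_subset: "f ` K \<subseteq> F"
    and r_eq: "i \<in> {1..n} \<Longrightarrow> r i = q"
    and s_pos: "0 < s" and q_powr: "q powr s = 1 / n" and pressure_F: "F.pressure s = 1"
begin

abbreviation wt :: "nat list \<Rightarrow> real" where
  "wt \<equiv> F.weight s"

text \<open>
  \<open>resolves l v\<close>: images of cylinders of generation \<open>l\<close> of \<open>K\<close> are smaller than the gap around the
  cylinder of \<open>v\<close>, so that they lie inside it or miss it. From such a generation on, \<open>cells l v\<close>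
  partitions the preimage of that cylinder. Thus \<open>\<theta> v\<close> is the measure of the preimage, and \<open>density\<close>
  compares this push-forward measure with the natural measure of \<open>F\<close>.
\<close>

definition resolves :: "nat \<Rightarrow> nat list \<Rightarrow> bool" where
  "resolves l v \<longleftrightarrow> L * q ^ l * diameter K < F.gap * F.ratio v"

definition cells :: "nat \<Rightarrow> nat list \<Rightarrow> nat list set" where
  "cells l v = {w \<in> words n l. f ` K.cyl w \<subseteq> F.cyl v}"

definition level :: "nat list \<Rightarrow> nat" where
  "level v = (LEAST l. resolves l v)"

definition \<theta> :: "nat list \<Rightarrow> real" where
  "\<theta> v = card (cells (level v) v) / n ^ level v"

definition density :: "nat list \<Rightarrow> real" where
  "density v = \<theta> v / wt v"

definition hit :: "nat list \<Rightarrow> bool" where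
  "hit v \<longleftrightarrow> F.cyl v \<inter> f ` K \<noteq> {}"

lemma n_pos: "0 < real n"
  using K.two_le_n by simp

lemma q_bounds: "0 < q" "q < 1"
proof -
  have "1 \<in> {1..n}"
    using K.two_le_n by simp
  then show "0 < q" "q < 1"
    using K.r_bounds[of 1] r_eq[of 1] by auto
qed

lemma L_nonneg: "0 \<le> L"
  using lip by (rule lipschitz_on_nonneg)

lemma ratio_K: "w \<in> words n l \<Longrightarrow> K.ratio w = q ^ l"
proof (induction w arbitrary: l)
  case (Cons i w)
  then have "w \<in> words n (length w)" "i \<in> {1..n}" "l = Suc (length w)"
    by (auto simp: words_def)
  with Cons.IH[of "length w"] show ?case
    by (simp add: r_eq)
qed (simp add: words_def)

lemma resolves_mono:
  assumes "resolves l v" "l \<le> l'" shows "resolves l' v"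
proof -
  have "L * q ^ l' * diameter K \<le> L * q ^ l * diameter K"
    using q_bounds assms(2) L_nonneg K.diameter_K_nonneg
    by (intro mult_right_mono mult_left_mono power_decreasing) auto
  then show ?thesis
    using assms(1) by (simp add: resolves_def)
qed

lemma resolves_prefix:
  assumes "set v \<subseteq> {1..m}" "set u \<subseteq> {1..m}" "resolves l (v @ u)" shows "resolves l v"
proof -
  have "F.ratio v * F.ratio u \<le> F.ratio v"
    using F.ratio_pos[OF assms(1)] F.ratio_le_1[OF assms(2)] by (simp add: mult_left_le)
  then have "F.gap * F.ratio (v @ u) \<le> F.gap * F.ratio v"
    using F.gap_pos by simp
  then show ?thesis
    using assms(3) by (simp add: resolves_def)
qed

lemma ex_resolves: assumes "set v \<subseteq> {1..m}" shows "\<exists>l. resolves l v"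
proof -
  have "(\<lambda>l. L * q ^ l * diameter K) \<longlonglongrightarrow> L * 0 * diameter K"
    using q_bounds by (intro tendsto_intros LIMSEQ_realpow_zero) auto
  moreover have "0 < F.gap * F.ratio v"
    using F.gap_pos F.ratio_pos[OF assms] by simp
  ultimately have "eventually (\<lambda>l. L * q ^ l * diameter K < F.gap * F.ratio v) sequentially"
    by (intro order_tendstoD(2)) auto
  then show ?thesis
    unfolding resolves_def by (auto simp: eventually_sequentially)
qed

lemma resolves_level: "set v \<subseteq> {1..m} \<Longrightarrow> resolves (level v) v"
  unfolding level_def using ex_resolves by (rule LeastI_ex)

lemma level_le: "resolves l v \<Longrightarrow> level v \<le> l"
  unfolding level_def by (rule Least_le)

lemma level_append: "set v \<subseteq> {1..m} \<Longrightarrow> set u \<subseteq> {1..m} \<Longrightarrow> level v \<le> level (v @ u)"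
  using resolves_level[of "v @ u"] by (intro level_le resolves_prefix[of v u]) auto

lemma resolves_dichotomy:
  assumes v: "set v \<subseteq> {1..m}" and resolves: "resolves l v" and w: "w \<in> words n l"
    and x: "x \<in> K.cyl w" "f x \<in> F.cyl v"
  shows "f ` K.cyl w \<subseteq> F.cyl v"
proof (rule image_subsetI, rule ccontr)
  fix y assume y: "y \<in> K.cyl w" "f y \<notin> F.cyl v"
  have sub: "K.cyl w \<subseteq> K"
    by (rule K.cyl_subset[OF wordsD[OF w]])
  then have "f y \<in> F"
    using y image_subset by auto
  then have "F.gap * F.ratio v \<le> dist (f x) (f y)"
    by (rule F.complement_separation[OF v x(2) _ y(2)])
  also have "\<dots> \<le> L * dist x y"
    using lipschitz_onD[OF lip] x y sub by blast
  also have "\<dots> \<le> L * (q ^ l * diameter K)"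
    using K.dist_cyl_le[OF wordsD[OF w] x(1) y(1)] L_nonneg
    by (intro mult_left_mono) (simp_all add: ratio_K[OF w])
  finally show False
    using resolves by (simp add: resolves_def mult.assoc)
qed

lemma finite_cells [simp]: "finite (cells l v)"
  by (simp add: cells_def)

lemma card_cells_add:
  assumes v: "set v \<subseteq> {1..m}" and resolves: "resolves l v"
  shows "card (cells (l + k) v) = card (cells l v) * n ^ k"
proof -
  have "bij_betw (\<lambda>(w, u). w @ u) (cells l v \<times> words n k) (cells (l + k) v)"
  proof (rule bij_betwI[where g = "\<lambda>w. (take l w, drop l w)"])
    show "(\<lambda>(w, u). w @ u) \<in> cells l v \<times> words n k \<rightarrow> cells (l + k) v"
    proof (rule funcsetI)
      fix p assume "p \<in> cells l v \<times> words n k"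
      then obtain w u where p: "p = (w, u)" "w \<in> words n l" "f ` K.cyl w \<subseteq> F.cyl v" "u \<in> words n k"
        by (auto simp: cells_def)
      then show "(case p of (w, u) \<Rightarrow> w @ u) \<in> cells (l + k) v"
        using K.cyl_append_subset[OF wordsD[OF p(4)], of w] words_append[OF p(2,4)]
        by (auto simp: cells_def)
    qed
    show "(\<lambda>w. (take l w, drop l w)) \<in> cells (l + k) v \<rightarrow> cells l v \<times> words n k"
    proof (rule funcsetI)
      fix w assume w: "w \<in> cells (l + k) v"
      have take: "take l w \<in> words n l" and drop: "drop l w \<in> words n k"
        using w by (auto simp: cells_def words_def dest: in_set_takeD in_set_dropD)
      obtain x where x: "x \<in> K.cyl w"
        using K.cyl_nonempty by blast
      have "x \<in> K.cyl (take l w)"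
        using x K.cyl_append_subset[OF wordsD[OF drop], of "take l w"] by auto
      moreover have "f x \<in> F.cyl v"
        using x w by (auto simp: cells_def)
      ultimately have "f ` K.cyl (take l w) \<subseteq> F.cyl v"
        by (rule resolves_dichotomy[OF v resolves take])
      then show "(take l w, drop l w) \<in> cells l v \<times> words n k"
        using take drop by (simp add: cells_def)
    qed
  qed (auto simp: cells_def words_def)
  then have "card (cells (l + k) v) = card (cells l v \<times> words n k)"
    by (metis bij_betw_same_card)
  then show ?thesis
    by (simp add: card_cartesian_product)
qed

text \<open>
  The value does not depend on the resolving generation at which the preimage is counted: a cell of
  generation \<open>l\<close> splits into \<open>n ^ k\<close> cells of generation \<open>l + k\<close>.
\<close>

lemma \<theta>_eq:
  assumes v: "set v \<subseteq> {1..m}" and resolves: "resolves l v"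
  shows "\<theta> v = card (cells l v) / n ^ l"
proof -
  obtain k where l: "l = level v + k"
    using level_le[OF resolves] le_Suc_ex by blast
  show ?thesis
    unfolding l card_cells_add[OF v resolves_level[OF v]] \<theta>_def using n_pos
    by (simp add: power_add)
qed

lemma card_cells_split:
  assumes v: "set v \<subseteq> {1..m}" and resolves: "\<And>u. u \<in> words m k \<Longrightarrow> resolves l (v @ u)"
  shows "card (cells l v) = (\<Sum>u\<in>words m k. card (cells l (v @ u)))"
proof -
  have "cells l v = (\<Union>u\<in>words m k. cells l (v @ u))"
  proof (intro equalityI subsetI)
    fix w assume w: "w \<in> cells l v"
    obtain x where x: "x \<in> K.cyl w"
      using K.cyl_nonempty by blast
    then have "f x \<in> F.cyl v"
      using w by (auto simp: cells_def)
    then obtain u where u: "u \<in> words m k" "f x \<in> F.cyl (v @ u)"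
      using F.cyl_extend[of v k] by blast
    have "set (v @ u) \<subseteq> {1..m}"
      using v wordsD[OF u(1)] by simp
    from resolves_dichotomy[OF this resolves[OF u(1)] _ x u(2)] show "w \<in> (\<Union>u\<in>words m k. cells l (v @ u))"
      using w u(1) by (auto simp: cells_def)
  next
    fix w assume "w \<in> (\<Union>u\<in>words m k. cells l (v @ u))"
    then obtain u where u: "u \<in> words m k" "w \<in> cells l (v @ u)"
      by blast
    then show "w \<in> cells l v"
      using F.cyl_append_subset[OF wordsD[OF u(1)], of v] by (auto simp: cells_def)
  qed
  also have "card \<dots> = (\<Sum>u\<in>words m k. card (cells l (v @ u)))"
  proof (rule card_UN_disjoint)
    show "\<forall>u\<in>words m k. \<forall>u'\<in>words m k. u \<noteq> u' \<longrightarrow> cells l (v @ u) \<inter> cells l (v @ u') = {}"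
    proof (intro ballI impI)
      fix u u' assume u: "u \<in> words m k" "u' \<in> words m k" "u \<noteq> u'"
      have "v \<in> words m (length v)"
        using v by (simp add: words_def)
      then have disj: "F.cyl (v @ u) \<inter> F.cyl (v @ u') = {}"
        using u by (intro F.cyl_disjoint[of _ "length v + k"] words_append) auto
      show "cells l (v @ u) \<inter> cells l (v @ u') = {}"
        using disj K.cyl_nonempty unfolding cells_def by blast
    qed
  qed simp_all
  finally show ?thesis .
qed

lemma \<theta>_split:
  assumes v: "set v \<subseteq> {1..m}"
  shows "\<theta> v = (\<Sum>u\<in>words m k. \<theta> (v @ u))"
proof -
  define l where "l = Max ((\<lambda>u. level (v @ u)) ` words m k)"
  have vu: "set (v @ u) \<subseteq> {1..m}" if "u \<in> words m k" for u
    using v wordsD[OF that] by simp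
  have resolves: "resolves l (v @ u)" if "u \<in> words m k" for u
    using resolves_level[OF vu[OF that]] unfolding l_def
    by (rule resolves_mono) (use that in \<open>auto intro!: Max_ge\<close>)
  obtain u where u: "u \<in> words m k"
    using F.K_nonempty F.ex_word_cyl[of _ k] by auto
  have "\<theta> v = card (cells l v) / n ^ l"
    using resolves_prefix[OF v wordsD[OF u] resolves[OF u]] by (rule \<theta>_eq[OF v])
  also have "\<dots> = (\<Sum>u\<in>words m k. card (cells l (v @ u)) / n ^ l)"
    by (subst card_cells_split[OF v resolves]) (auto simp: sum_divide_distrib)
  also have "\<dots> = (\<Sum>u\<in>words m k. \<theta> (v @ u))"
    by (intro sum.cong refl \<theta>_eq[symmetric] vu resolves)
  finally show ?thesis .
qed

lemma \<theta>_Nil: "\<theta> [] = 1"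
proof -
  have "cells (level []) [] = words n (level [])"
    using K.cyl_subset[OF wordsD] image_subset unfolding cells_def F.cyl_Nil by blast
  then show ?thesis
    using n_pos by (simp add: \<theta>_def)
qed

lemma sum_\<theta>: "(\<Sum>v\<in>words m k. \<theta> v) = 1"
  using \<theta>_split[of "[]" k] \<theta>_Nil by simp

lemma \<theta>_nonneg: "0 \<le> \<theta> v"
  by (simp add: \<theta>_def)

lemma wt_pos: "set v \<subseteq> {1..m} \<Longrightarrow> 0 < wt v"
  by (rule F.weight_pos)

lemma sum_wt: "(\<Sum>v\<in>words m k. wt v) = 1"
  by (simp add: F.sum_weight pressure_F)

text \<open>
  The first resolving generation of \<open>v\<close> is not too late: its cells are comparable in size to the
  cylinder of \<open>v\<close>, hence (as \<open>q powr s = 1 / n\<close>) comparable in measure.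
\<close>

lemma level_bound:
  "\<exists>\<kappa>>0. \<forall>v. set v \<subseteq> {1..m} \<longrightarrow> \<kappa> * wt v \<le> 1 / n ^ level v"
proof -
  define c0 where "c0 = min 1 (q * F.gap / (L * diameter K + 1))"
  have LD: "0 \<le> L * diameter K"
    using L_nonneg K.diameter_K_nonneg by simp
  have c0: "0 < c0"
    using q_bounds F.gap_pos LD unfolding c0_def by (simp add: divide_pos_pos)
  have *: "c0 * F.ratio v \<le> q ^ level v" if v: "set v \<subseteq> {1..m}" for v
  proof (cases "level v")
    case 0
    have "c0 * F.ratio v \<le> 1 * 1"
      using F.ratio_pos[OF v] F.ratio_le_1[OF v] by (intro mult_mono) (auto simp: c0_def)
    then show ?thesis
      using 0 by simp
  next
    case (Suc l)
    then have "\<not> resolves l v"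
      using level_le[of l v] by auto
    then have "F.gap * F.ratio v \<le> (L * diameter K) * q ^ l"
      by (simp add: resolves_def mult_ac)
    also have "\<dots> \<le> (L * diameter K + 1) * q ^ l"
      using q_bounds by (intro mult_right_mono) auto
    finally have "q * (F.gap * F.ratio v) \<le> q * ((L * diameter K + 1) * q ^ l)"
      using q_bounds by (intro mult_left_mono) auto
    then have "q * F.gap / (L * diameter K + 1) * F.ratio v \<le> q ^ level v"
      using LD by (simp add: Suc field_simps)
    moreover have "c0 * F.ratio v \<le> q * F.gap / (L * diameter K + 1) * F.ratio v"
      using F.ratio_pos[OF v] by (intro mult_right_mono) (auto simp: c0_def)
    ultimately show ?thesis
      by linarith
  qed
  show ?thesis
  proof (intro exI[of _ "c0 powr s"] conjI allI impI)
    show "0 < c0 powr s"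
      using c0 by simp
    fix v assume v: "set v \<subseteq> {1..m}"
    have "c0 powr s * wt v = (c0 * F.ratio v) powr s"
      using c0 F.ratio_pos[OF v] by (simp add: F.weight_eq[OF v] powr_mult)
    also have "\<dots> \<le> (q ^ level v) powr s"
      using *[OF v] c0 F.ratio_pos[OF v] s_pos by (intro powr_mono2) auto
    also have "\<dots> = (q powr s) ^ level v"
      using q_bounds by (simp add: powr_powr powr_realpow[symmetric] mult.commute)
    also have "\<dots> = 1 / n ^ level v"
      by (simp add: q_powr power_one_over)
    finally show "c0 powr s * wt v \<le> 1 / n ^ level v" .
  qed
qed

definition density_floor :: real where
  "density_floor = (SOME \<kappa>. \<kappa> > 0 \<and> (\<forall>v. set v \<subseteq> {1..m} \<longrightarrow> \<kappa> * wt v \<le> 1 / n ^ level v))"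

lemma density_floor_pos: "0 < density_floor"
  and density_floor_wt_le: "set v \<subseteq> {1..m} \<Longrightarrow> density_floor * wt v \<le> 1 / n ^ level v"
  using someI_ex[OF level_bound] unfolding density_floor_def by auto

text \<open>
  If the cylinder is hit, its preimage contains a whole cell.
\<close>

lemma density_ge:
  assumes v: "set v \<subseteq> {1..m}" and "hit v" shows "density_floor \<le> density v"
proof -
  obtain x where x: "x \<in> K" "f x \<in> F.cyl v"
    using \<open>hit v\<close> by (auto simp: hit_def)
  obtain w where w: "w \<in> words n (level v)" "x \<in> K.cyl w"
    using K.ex_word_cyl[OF x(1)] by blast
  then have "w \<in> cells (level v) v"
    using resolves_dichotomy[OF v resolves_level[OF v] w x(2)] by (simp add: cells_def)
  then have "1 \<le> card (cells (level v) v)"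
    by (metis One_nat_def Suc_leI card_gt_0_iff empty_iff finite_cells)
  then have "1 / n ^ level v \<le> \<theta> v"
    unfolding \<theta>_def by (intro divide_right_mono) auto
  then show ?thesis
    using density_floor_wt_le[OF v] wt_pos[OF v] by (simp add: density_def field_simps)
qed

lemma card_cells_le:
  assumes v: "set v \<subseteq> {1..m}"
  shows "card (cells (level v) v) \<le> density v / density_floor"
proof -
  have "card (cells (level v) v) = density v * wt v * n ^ level v"
    using wt_pos[OF v] n_pos by (simp add: density_def \<theta>_def)
  also have "\<dots> = density v * (wt v * n ^ level v)"
    by simp
  also have "\<dots> \<le> density v * (1 / density_floor)"
  proof (rule mult_left_mono)
    show "wt v * n ^ level v \<le> 1 / density_floor"
      using density_floor_wt_le[OF v] density_floor_pos n_pos by (simp add: field_simps)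
  qed (use wt_pos[OF v] \<theta>_nonneg in \<open>simp add: density_def\<close>)
  finally show ?thesis
    by simp
qed

lemma hit_prefix: "set u \<subseteq> {1..m} \<Longrightarrow> hit (v @ u) \<Longrightarrow> hit v"
  using F.cyl_append_subset[of u v] by (auto simp: hit_def)

lemma mass_eq: "F.mass s (f ` K) k = (\<Sum>v\<in>words m k. if hit v then wt v else 0)"
  unfolding F.mass_def F.hits_def hit_def[symmetric] by (rule sum.inter_filter) simp

text \<open>
  Here positivity of the measure of the image enters, as \<open>\<eta>\<close>. The masses of the image decrease to a
  positive limit, so between late generations \<open>k\<close> and \<open>k + P\<close> hardly any mass is lost. A word of
  generation \<open>k\<close> that is hit but has a missed descendant \<open>P\<close> generations later loses at least the
  fraction \<open>\<tau>\<close> of its weight, so such words have total weight below \<open>\<eta> / 2\<close>. The others have total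
  weight above \<open>\<eta> / 2\<close>; were all their densities above \<open>2 / \<eta>\<close>, the push-forward measure would have
  total mass above \<open>1\<close>.
\<close>

lemma saturated_vertex:
  assumes \<eta>: "0 < \<eta>" "\<And>k. \<eta> \<le> F.mass s (f ` K) k"
  shows "\<exists>v. set v \<subseteq> {1..m} \<and> density v \<le> 2 / \<eta> \<and> (\<forall>u\<in>words m P. hit (v @ u))"
proof -
  define \<tau> where "\<tau> = Min (wt ` words m P)"
  have "words m P \<noteq> {}"
    using F.K_nonempty F.ex_word_cyl[of _ P] by auto
  then have "\<tau> \<in> wt ` words m P"
    unfolding \<tau>_def by (intro Min_in) auto
  then have \<tau>_pos: "0 < \<tau>"
    using wt_pos wordsD by auto
  have \<tau>_le: "\<tau> \<le> wt u" if "u \<in> words m P" for u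
    unfolding \<tau>_def using that by (intro Min_le) auto
  let ?M = "F.mass s (f ` K)"
  have dec: "antimono ?M"
    by (rule F.mass_antimono) (simp add: pressure_F)
  have "convergent ?M"
    using decseq_convergent[OF dec, of 0] F.mass_nonneg by (metis convergentI)
  then have "Cauchy ?M"
    by (rule convergent_Cauchy)
  then obtain k where "\<forall>i\<ge>k. \<forall>j\<ge>k. dist (?M i) (?M j) < \<tau> * \<eta> / 2"
    using \<tau>_pos \<eta>(1) unfolding Cauchy_def by (metis half_gt_zero mult_pos_pos)
  then have "dist (?M k) (?M (k + P)) < \<tau> * \<eta> / 2"
    by simp
  then have drop: "?M k - ?M (k + P) < \<tau> * \<eta> / 2"
    unfolding dist_real_def by linarith
  define bad where "bad v \<longleftrightarrow> hit v \<and> (\<exists>u\<in>words m P. \<not> hit (v @ u))" for v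
  have bad_le: "(\<Sum>u\<in>words m P. if hit (v @ u) then wt (v @ u) else 0) \<le>
      (if hit v then wt v else 0) - (if bad v then wt v * \<tau> else 0)" (is "?S \<le> _") for v
  proof (cases "bad v")
    case True
    then obtain u where u: "u \<in> words m P" "\<not> hit (v @ u)"
      by (auto simp: bad_def)
    have "?S = (\<Sum>u'\<in>words m P - {u}. if hit (v @ u') then wt (v @ u') else 0)"
      using u by (intro sum.mono_neutral_right) auto
    also have "\<dots> \<le> (\<Sum>u'\<in>words m P - {u}. wt v * wt u')"
      by (intro sum_mono) auto
    also have "\<dots> = wt v * (1 - wt u)"
      using u(1) by (simp add: sum_distrib_left[symmetric] sum_diff1 sum_wt)
    also have "\<dots> \<le> wt v * (1 - \<tau>)"
      using \<tau>_le[OF u(1)] by (intro mult_left_mono) auto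
    finally show ?thesis
      using True by (simp add: bad_def algebra_simps)
  next
    case False
    show ?thesis
    proof (cases "hit v")
      case True
      have "?S \<le> (\<Sum>u\<in>words m P. wt v * wt u)"
        by (intro sum_mono) auto
      also have "\<dots> = wt v"
        by (simp add: sum_distrib_left[symmetric] sum_wt)
      finally show ?thesis
        using True False by simp
    next
      case nohit: False
      have "?S = 0"
        using nohit hit_prefix[OF wordsD] by (intro sum.neutral) auto
      then show ?thesis
        using False nohit by simp
    qed
  qed
  define Bad where "Bad = (\<Sum>v\<in>words m k. if bad v then wt v else 0)"
  have "?M (k + P) \<le> (\<Sum>v\<in>words m k. (if hit v then wt v else 0) - (if bad v then wt v * \<tau> else 0))"
    unfolding mass_eq sum_words_add by (intro sum_mono bad_le)
  also have "\<dots> = ?M k - (\<Sum>v\<in>words m k. if bad v then wt v * \<tau> else 0)"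
    by (simp add: sum_subtractf mass_eq)
  also have "(\<Sum>v\<in>words m k. if bad v then wt v * \<tau> else 0) = \<tau> * Bad"
    unfolding Bad_def sum_distrib_left by (intro sum.cong) auto
  finally have "\<tau> * Bad < \<tau> * (\<eta> / 2)"
    using drop by simp
  then have Bad: "Bad < \<eta> / 2"
    using \<tau>_pos by simp
  define good where "good = {v \<in> words m k. hit v \<and> \<not> bad v}"
  have "?M k = (\<Sum>v\<in>good. wt v) + Bad"
    unfolding mass_eq Bad_def good_def sum.inter_filter[OF finite_words] sum.distrib[symmetric]
    by (intro sum.cong) (auto simp: bad_def)
  then have good_sum: "\<eta> / 2 < (\<Sum>v\<in>good. wt v)"
    using Bad \<eta>(2)[of k] by simp
  have "\<exists>v\<in>good. density v \<le> 2 / \<eta>"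
  proof (rule ccontr)
    assume "\<not> ?thesis"
    then have large: "2 / \<eta> * wt v \<le> \<theta> v" if "v \<in> good" for v
      using that wt_pos[OF wordsD[of v m k]] by (auto simp: good_def density_def field_simps)
    have "1 < 2 / \<eta> * (\<Sum>v\<in>good. wt v)"
      using good_sum \<eta>(1) by (simp add: field_simps)
    also have "\<dots> \<le> (\<Sum>v\<in>good. \<theta> v)"
      unfolding sum_distrib_left by (intro sum_mono large)
    also have "\<dots> \<le> (\<Sum>v\<in>words m k. \<theta> v)"
      by (intro sum_mono2) (auto simp: good_def \<theta>_nonneg)
    finally show False
      by (simp add: sum_\<theta>)
  qed
  then obtain v where "v \<in> good" "density v \<le> 2 / \<eta>"
    by blast
  then show ?thesis
    using wordsD[of v m k] by (intro exI[of _ v]) (auto simp: good_def bad_def)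
qed

text \<open>
  As long as some descendant \<open>d\<close> generations later has density smaller by the factor \<open>1 - \<epsilon>\<close>, pass to
  it. After \<open>S\<close> such steps the density would be below the lower bound for words that are hit.
\<close>

lemma descent:
  assumes \<epsilon>: "0 < \<epsilon>" "\<epsilon> < 1"
  shows "set v \<subseteq> {1..m} \<Longrightarrow> \<forall>u\<in>words m (d * S). hit (v @ u) \<Longrightarrow> density v * (1 - \<epsilon>) ^ S < density_floor \<Longrightarrow>
    \<exists>v'. set v' \<subseteq> {1..m} \<and> density_floor \<le> density v' \<and> density v' \<le> density v \<and> (\<forall>u\<in>words m d. (1 - \<epsilon>) * density v' \<le> density (v' @ u))"
proof (induction S arbitrary: v)
  case 0
  then have "density_floor \<le> density v"
    using density_ge[of v] by simp
  then show ?case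
    using 0 by simp
next
  case (Suc S)
  show ?case
  proof (cases "\<forall>u\<in>words m d. (1 - \<epsilon>) * density v \<le> density (v @ u)")
    case True
    obtain u where u: "u \<in> words m (d * Suc S)"
      using F.K_nonempty F.ex_word_cyl[of _ "d * Suc S"] by blast
    then have "hit (v @ u)"
      using Suc.prems(2) by blast
    then have "hit v"
      by (rule hit_prefix[OF wordsD[OF u]])
    then have "density_floor \<le> density v"
      by (rule density_ge[OF Suc.prems(1)])
    with True Suc.prems(1) show ?thesis
      by blast
  next
    case False
    then obtain u where u: "u \<in> words m d" and less: "density (v @ u) < (1 - \<epsilon>) * density v"
      by auto
    have vu: "set (v @ u) \<subseteq> {1..m}"
      using Suc.prems(1) wordsD[OF u] by simp
    have hits: "\<forall>u'\<in>words m (d * S). hit ((v @ u) @ u')"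
      using words_append[OF u] Suc.prems(2) by simp
    have "density (v @ u) * (1 - \<epsilon>) ^ S \<le> (1 - \<epsilon>) * density v * (1 - \<epsilon>) ^ S"
      using less \<epsilon> by (intro mult_right_mono) auto
    also have "\<dots> < density_floor"
      using Suc.prems(3) by (simp add: mult_ac)
    finally have small: "density (v @ u) * (1 - \<epsilon>) ^ S < density_floor" .
    have "0 \<le> density v"
      by (simp add: density_def \<theta>_nonneg)
    then have "density (v @ u) \<le> density v"
      using less \<epsilon> mult_right_mono[of "1 - \<epsilon>" 1 "density v"] by simp
    with Suc.IH[OF vu hits small] show ?thesis
      by (meson order_trans)
  qed
qed

text \<open>
  \<open>S\<close> is the number of steps that \<open>descent\<close> needs, and saturation to depth \<open>d * S\<close> makes all words it can
  visit be hit. A one-sided bound on the densities suffices, since the density of a word is the weighted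
  mean of the densities of its descendants.
\<close>

lemma flat_vertex:
  assumes \<eta>: "0 < \<eta>" "\<And>k. \<eta> \<le> F.mass s (f ` K) k" and \<epsilon>: "0 < \<epsilon>" "\<epsilon> < 1"
  shows "\<exists>v. set v \<subseteq> {1..m} \<and> density_floor \<le> density v \<and> density v \<le> 2 / \<eta> \<and> (\<forall>u\<in>words m d. (1 - \<epsilon>) * density v \<le> density (v @ u))"
proof -
  obtain S where S: "(1 - \<epsilon>) ^ S < density_floor * \<eta> / 2"
    using real_arch_pow_inv[of "density_floor * \<eta> / 2" "1 - \<epsilon>"] density_floor_pos \<eta>(1) \<epsilon> by auto
  obtain v where v: "set v \<subseteq> {1..m}" "density v \<le> 2 / \<eta>" "\<forall>u\<in>words m (d * S). hit (v @ u)"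
    using saturated_vertex[OF \<eta>] by blast
  have "density v * (1 - \<epsilon>) ^ S \<le> 2 / \<eta> * (1 - \<epsilon>) ^ S"
    using v(2) \<epsilon> by (intro mult_right_mono) auto
  also have "\<dots> < density_floor"
    using S \<eta>(1) by (simp add: field_simps)
  finally show ?thesis
    using descent[OF \<epsilon> v(1,3)] v(2) by (meson order_trans)
qed

text \<open>
  At an \<open>\<epsilon>\<close>-flat word \<open>v\<close> the quotient \<open>\<theta> (v @ u) / \<theta> v\<close> is \<open>\<epsilon>\<close>-close to \<open>wt u\<close>, and it is
  \<open>a / (b n ^ e)\<close> where \<open>a\<close> and \<open>b\<close> count cells at the respective levels. For fixed \<open>u\<close> also the exponent
  is bounded, so these quotients range over a finite set \<open>Y\<close>; being a limit of elements of \<open>Y\<close>, the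
  weight \<open>wt u\<close> belongs to it. The uniformity of \<open>M\<close> in \<open>u\<close> is what the later pigeonhole argument needs.
\<close>

lemma weights_rational_of_bounded_height:
  assumes \<eta>: "0 < \<eta>" "\<And>k. \<eta> \<le> F.mass s (f ` K) k"
  shows "\<exists>M. \<forall>u. set u \<subseteq> {1..m} \<longrightarrow>
    (\<exists>a b e. a \<in> {1..M} \<and> b \<in> {1..M} \<and> wt u = real a / (real b * real n ^ e))"
proof -
  define B where "B = 4 / (\<eta> * density_floor)"
  define M where "M = nat \<lfloor>B\<rfloor>"
  have le_M: "x \<le> M" if "real x \<le> B" for x :: nat
    using that by (simp add: M_def le_nat_floor)
  have "\<exists>a b e. a \<in> {1..M} \<and> b \<in> {1..M} \<and> wt u = real a / (real b * real n ^ e)"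
    if u: "set u \<subseteq> {1..m}" for u
  proof -
    define d where "d = length u"
    have ud: "u \<in> words m d"
      using u by (simp add: words_def d_def)
    \<comment> \<open>Bounds the exponent: \<open>wt u / 2 \<le> a / n ^ e\<close> and \<open>a \<le> B\<close>.\<close>
    define E where "E = nat \<lfloor>2 * B / wt u\<rfloor>"
    define Y where "Y = (\<lambda>(a, b, e). real a / (real b * real n ^ e)) ` ({1..M} \<times> {1..M} \<times> {..E})"
    have "closed Y"
      unfolding Y_def by (intro finite_imp_closed finite_imageI finite_cartesian_product) auto
    moreover have "\<exists>y\<in>Y. dist y (wt u) < \<delta>" if \<delta>: "0 < \<delta>" for \<delta>
    proof -
      define \<epsilon> where "\<epsilon> = min (\<delta> / 2) (min (wt u / 2) (1 / 2))"
      have \<epsilon>: "0 < \<epsilon>" "\<epsilon> < 1" "\<epsilon> < \<delta>" "\<epsilon> \<le> wt u / 2"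
        using \<delta> wt_pos[OF u] by (auto simp: \<epsilon>_def min_def)
      obtain v where v: "set v \<subseteq> {1..m}" "density_floor \<le> density v" "density v \<le> 2 / \<eta>"
        and flat: "\<And>u. u \<in> words m d \<Longrightarrow> (1 - \<epsilon>) * density v \<le> density (v @ u)"
        using flat_vertex[OF \<eta> \<epsilon>(1,2), of d] by blast
      have vu: "set (v @ u) \<subseteq> {1..m}"
        using u v by simp
      have wv: "0 < wt v"
        by (rule wt_pos[OF v(1)])
      have \<theta>v: "0 < \<theta> v"
      proof -
        have "0 < density v"
          using v(2) density_floor_pos by linarith
        then show ?thesis
          using wv by (simp add: density_def zero_less_divide_iff)
      qed
      have flat_\<theta>: "(1 - \<epsilon>) * \<theta> v * wt u' \<le> \<theta> (v @ u')" if "u' \<in> words m d" for u'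
      proof -
        have wu': "0 < wt u'"
          by (rule wt_pos[OF wordsD[OF that]])
        then have "(1 - \<epsilon>) * density v * (wt v * wt u') \<le> density (v @ u') * (wt v * wt u')"
          using wv by (intro mult_right_mono flat[OF that]) simp
        then show ?thesis
          using wv wu' by (simp add: density_def)
      qed
      \<comment> \<open>The upper bound for \<open>u\<close> comes from the lower bounds for all other words of length \<open>d\<close>.\<close>
      have "\<theta> v = (\<Sum>u'\<in>words m d. \<theta> (v @ u'))"
        by (rule \<theta>_split[OF v(1)])
      also have "\<dots> = \<theta> (v @ u) + (\<Sum>u'\<in>words m d - {u}. \<theta> (v @ u'))"
        using ud by (simp add: sum.remove)
      finally have "\<theta> (v @ u) = \<theta> v - (\<Sum>u'\<in>words m d - {u}. \<theta> (v @ u'))"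
        by simp
      also have "\<dots> \<le> \<theta> v - (\<Sum>u'\<in>words m d - {u}. (1 - \<epsilon>) * \<theta> v * wt u')"
        by (intro diff_left_mono sum_mono flat_\<theta>) auto
      also have "(\<Sum>u'\<in>words m d - {u}. (1 - \<epsilon>) * \<theta> v * wt u') = (1 - \<epsilon>) * \<theta> v * (1 - wt u)"
        using ud by (simp add: sum_distrib_left[symmetric] sum_diff1 sum_wt)
      also have "\<theta> v - \<dots> = \<theta> v * (wt u + \<epsilon>) - \<theta> v * \<epsilon> * wt u"
        by (simp add: algebra_simps)
      also have "\<dots> \<le> \<theta> v * (wt u + \<epsilon>)"
        using \<theta>v \<epsilon> wt_pos[OF u] by simp
      finally have upper: "\<theta> (v @ u) \<le> \<theta> v * (wt u + \<epsilon>)" .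
      have "wt u \<le> (\<Sum>u\<in>words m d. wt u)"
        using ud by (intro member_le_sum) auto
      then have wt_le_1: "wt u \<le> 1"
        by (simp add: sum_wt)
      have lower: "\<theta> v * (wt u - \<epsilon>) \<le> \<theta> (v @ u)"
      proof -
        have "\<theta> v * (wt u - \<epsilon>) \<le> \<theta> v * (wt u - \<epsilon> * wt u)"
          using \<theta>v \<epsilon> wt_le_1 by (intro mult_left_mono) (auto simp: mult_left_le)
        also have "\<dots> \<le> \<theta> (v @ u)"
          using flat_\<theta>[OF ud] by (simp add: algebra_simps)
        finally show ?thesis .
      qed
      define a where "a = card (cells (level (v @ u)) (v @ u))"
      define b where "b = card (cells (level v) v)"
      define e where "e = level (v @ u) - level v"
      have lev: "level (v @ u) = level v + e"
        using level_append[OF v(1) u] by (simp add: e_def)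
      have b_pos: "0 < b"
        using \<theta>v n_pos by (simp add: \<theta>_def b_def zero_less_divide_iff)
      have ratio: "\<theta> (v @ u) / \<theta> v = real a / (real b * real n ^ e)"
      proof -
        have e1: "\<theta> (v @ u) = a / (n ^ level v * n ^ e)"
          by (simp add: \<theta>_def a_def lev power_add)
        have e2: "\<theta> v = b / n ^ level v"
          by (simp add: \<theta>_def b_def)
        show ?thesis
          unfolding e1 e2 using n_pos b_pos by (simp add: field_simps)
      qed
      have near: "\<bar>\<theta> (v @ u) / \<theta> v - wt u\<bar> \<le> \<epsilon>"
        using upper lower \<theta>v by (simp add: abs_le_iff field_simps)
      have "real b \<le> 2 / \<eta> / density_floor"
        using card_cells_le[OF v(1)] divide_right_mono[OF v(3), of density_floor] density_floor_pos unfolding b_def by simp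
      also have "\<dots> \<le> B"
        using \<eta>(1) density_floor_pos by (simp add: B_def field_simps)
      finally have b_le: "b \<le> M"
        by (rule le_M)
      have "density (v @ u) \<le> 2 * density v"
      proof -
        have "\<theta> v * (wt u + \<epsilon>) \<le> \<theta> v * (2 * wt u)"
          using \<epsilon>(4) \<theta>v wt_pos[OF u] by (intro mult_left_mono) auto
        with upper have "\<theta> (v @ u) \<le> \<theta> v * (2 * wt u)"
          by linarith
        then show ?thesis
          using wv wt_pos[OF u] by (simp add: density_def field_simps)
      qed
      also have "2 * density v \<le> 4 / \<eta>"
        using v(3) by simp
      finally have "real a \<le> 4 / \<eta> / density_floor"
        using card_cells_le[OF vu] divide_right_mono[of "density (v @ u)" "4 / \<eta>" density_floor] density_floor_pos unfolding a_def by simp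
      then have a_B: "real a \<le> B"
        by (simp add: B_def)
      then have a_le: "a \<le> M"
        by (rule le_M)
      have half: "wt u / 2 \<le> real a / (real b * real n ^ e)"
        using near \<epsilon>(4) unfolding ratio by linarith
      then have a_pos: "0 < a"
        using wt_pos[OF u] by (cases "a = 0") auto
      have "wt u / 2 \<le> real a / real n ^ e"
      proof -
        have "real a / (real b * real n ^ e) \<le> real a / real n ^ e"
          using b_pos n_pos by (intro divide_left_mono) auto
        then show ?thesis
          using half by linarith
      qed
      then have "real n ^ e \<le> 2 * real a / wt u"
        using n_pos wt_pos[OF u] by (simp add: field_simps)
      also have "\<dots> \<le> 2 * B / wt u"
        using a_B wt_pos[OF u] by (intro divide_right_mono) auto
      finally have "real (n ^ e) \<le> 2 * B / wt u"
        by simp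
      moreover have "e \<le> n ^ e"
        using K.two_le_n by (intro less_imp_le power_gt_expt) simp
      ultimately have e_le: "e \<le> E"
        unfolding E_def by (intro le_nat_floor) (meson of_nat_le_iff order_trans)
      show ?thesis
      proof (rule bexI)
        show "dist (real a / (real b * real n ^ e)) (wt u) < \<delta>"
          using near \<epsilon>(3) unfolding ratio by (simp add: dist_real_def)
        show "real a / (real b * real n ^ e) \<in> Y"
          unfolding Y_def using a_pos b_pos a_le b_le e_le by (intro image_eqI[of _ _ "(a, b, e)"]) auto
      qed
    qed
    ultimately have "wt u \<in> Y"
      by (metis closed_approachable)
    then obtain a b e where "a \<in> {1..M}" "b \<in> {1..M}" "wt u = real a / (real b * real n ^ e)"
      by (auto simp: Y_def)
    then show ?thesis
      by blast
  qed
  then show ?thesis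
    by blast
qed

end

section \<open>Contraction ratios of the target\<close>

context lipschitz_pair
begin

text \<open>
  With \<open>x = t j powr s\<close>, the numerators and denominators of all powers \<open>x ^ k\<close> are bounded up to powers
  of \<open>n\<close>, so two of them agree for different \<open>k\<close>, whence \<open>x ^ p * n ^ e = 1\<close>. As \<open>x\<close> is also rational,
  \<open>1 / x\<close> is a rational root of an integer, hence an integer.
\<close>

lemma weight_is_integer_reciprocal:
  assumes \<eta>: "0 < \<eta>" "\<And>k. \<eta> \<le> F.mass s (f ` K) k" and j: "j \<in> {1..m}"
  shows "\<exists>k p e. 0 < p \<and> 0 < e \<and> k ^ p = n ^ e \<and> t j powr s = 1 / real k"
proof -
  define x where "x = t j powr s"
  have x: "0 < x" "x < 1"
    using F.r_bounds[OF j] s_pos powr_less_mono2[of s "t j" 1] by (auto simp: x_def)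
  have wt_replicate: "wt (replicate k j) = x ^ k" for k
    by (induction k) (simp_all add: x_def)
  obtain M where M: "\<And>u. set u \<subseteq> {1..m} \<Longrightarrow>
      \<exists>a b e. a \<in> {1..M} \<and> b \<in> {1..M} \<and> wt u = real a / (real b * real n ^ e)"
    using weights_rational_of_bounded_height[OF \<eta>] by blast
  have "\<exists>a b e. a \<in> {1..M} \<and> b \<in> {1..M} \<and> x ^ k = real a / (real b * real n ^ e)" for k
  proof -
    have "set (replicate k j) \<subseteq> {1..m}"
      using j by (auto simp: set_replicate_conv_if)
    from M[OF this] show ?thesis
      by (simp only: wt_replicate)
  qed
  then obtain A B E where ABE: "\<And>k. A k \<in> {1..M}" "\<And>k. B k \<in> {1..M}"
      "\<And>k. x ^ k = real (A k) / (real (B k) * real n ^ E k)"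
    by metis
  have AB_pos: "0 < A k" "0 < B k" for k
    using ABE(1,2)[of k] by auto
  have fin: "finite (range (\<lambda>k. (A k, B k)))"
  proof (rule finite_subset)
    show "range (\<lambda>k. (A k, B k)) \<subseteq> {1..M} \<times> {1..M}"
      using ABE(1,2) by blast
  qed simp
  have "\<exists>k l. k \<noteq> l \<and> A k = A l \<and> B k = B l"
  proof (rule ccontr)
    assume no: "\<not> ?thesis"
    have "inj (\<lambda>k. (A k, B k))"
    proof (rule injI)
      fix k l assume "(A k, B k) = (A l, B l)"
      then have "A k = A l \<and> B k = B l"
        by (rule Pair_inject) (rule conjI)
      with no show "k = l"
        by metis
    qed
    from finite_imageD[OF fin this] show False
      by (rule notE[OF infinite_UNIV_nat])
  qed
  then obtain k' l' where "k' \<noteq> l'" and eq': "A k' = A l'" "B k' = B l'"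
    by (elim exE conjE)
  define k l where "k = min k' l'" and "l = max k' l'"
  have "k < l" and eq: "A k = A l" "B k = B l"
    using \<open>k' \<noteq> l'\<close> eq' by (auto simp: k_def l_def min_def max_def)
  define p where "p = l - k"
  have p: "0 < p" "l = k + p"
    using \<open>k < l\<close> by (simp_all add: p_def)
  have xp: "x ^ p * real n ^ E l = real n ^ E k"
  proof -
    have "x ^ k * x ^ p = x ^ l"
      by (simp add: p(2) power_add)
    also have "\<dots> = real (A k) / (real (B k) * real n ^ E l)"
      using ABE(3)[of l] by (simp only: eq)
    finally show ?thesis
      using AB_pos[of k] n_pos unfolding ABE(3)[of k] by (simp add: field_simps)
  qed
  have "x ^ p < 1"
    using x p by (simp add: power_less_one_iff)
  then have "real n ^ E k < real n ^ E l"
    using mult_strict_right_mono[of "x ^ p" 1 "real n ^ E l"] n_pos by (simp add: xp)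
  then have less: "E k < E l"
    using K.two_le_n by (simp add: power_strict_increasing_iff)
  define e where "e = E l - E k"
  have e: "0 < e" "E l = E k + e"
    using less by (simp_all add: e_def)
  have xpe: "x ^ p * real n ^ e = 1"
    using xp n_pos unfolding e(2) by (simp add: power_add)
  define u where "u = A 1"
  define w where "w = B 1 * n ^ E 1"
  have uw: "0 < u" "0 < w" "x = real u / real w"
    using AB_pos[of 1] n_pos ABE(3)[of 1] by (simp_all add: u_def w_def)
  have "real (u ^ p * n ^ e) = real (w ^ p)"
    using xpe uw(2) unfolding uw(3) by (simp add: power_divide field_simps)
  then have nat_eq: "u ^ p * n ^ e = w ^ p"
    by (simp only: of_nat_eq_iff)
  then have "u ^ p dvd w ^ p"
    by (metis dvd_triv_left)
  then have "u dvd w"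
    using p(1) by (simp add: pow_divides_pow_iff)
  then obtain d where d: "w = u * d" ..
  have "d ^ p = n ^ e"
    using nat_eq uw(1) by (simp add: d power_mult_distrib)
  moreover have "x = 1 / real d"
    using uw by (simp add: d)
  ultimately show ?thesis
    using p(1) e(1) unfolding x_def by blast
qed

end


section \<open>Multiplicative dependence of integers\<close>

text \<open>
  Unique factorisation: \<open>p\<close> divides \<open>q\<close> times each exponent in the factorisation of \<open>b\<close>.
\<close>

lemma nth_root_of_coprime_power:
  fixes a b :: nat
  assumes "a ^ p = b ^ q" "coprime p q" "0 < p" "0 < b"
  shows "\<exists>c. b = c ^ p"
proof -
  have "is_nth_power p (b ^ q)"
    using assms(1) by (metis is_nth_power_def)
  then have "\<forall>l. prime l \<longrightarrow> p dvd multiplicity l (b ^ q)"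
    using assms by (subst (asm) is_nth_power_conv_multiplicity_nat) auto
  then have "\<forall>l. prime l \<longrightarrow> p dvd multiplicity l b"
    using assms by (auto simp: prime_elem_multiplicity_power_distrib coprime_dvd_mult_right_iff)
  then have "is_nth_power p b"
    using assms by (subst is_nth_power_conv_multiplicity_nat) auto
  then show ?thesis
    by (auto simp: is_nth_power_def)
qed

text \<open>
  The base is the smallest \<open>a \<ge> 2\<close> of which \<open>n\<close> is a power. Minimality means that \<open>a\<close> is not a proper
  power, so in a relation \<open>k ^ p' = a ^ q'\<close> with coprime exponents \<open>p'\<close> must be \<open>1\<close>. One base serves all
  \<open>k\<close> simultaneously.
\<close>

lemma common_base:
  fixes n :: nat
  assumes "2 \<le> n"
  shows "\<exists>a \<alpha>. 2 \<le> a \<and> 1 \<le> \<alpha> \<and> n = a ^ \<alpha> \<and>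
    (\<forall>k p q. 0 < p \<longrightarrow> 0 < q \<longrightarrow> k ^ p = n ^ q \<longrightarrow> (\<exists>\<beta>. k = a ^ \<beta>))"
proof -
  define P where "P a \<longleftrightarrow> 2 \<le> a \<and> (\<exists>\<alpha>\<ge>1. n = a ^ \<alpha>)" for a :: nat
  have "P n"
    using assms by (auto simp: P_def intro!: exI[of _ 1])
  define a where "a = (LEAST a. P a)"
  have "P a"
    unfolding a_def using \<open>P n\<close> by (rule LeastI)
  then obtain \<alpha> where a: "2 \<le> a" "1 \<le> \<alpha>" "n = a ^ \<alpha>"
    by (auto simp: P_def)
  have min: "a \<le> b" if "P b" for b
    unfolding a_def using that by (rule Least_le)
  have "\<exists>\<beta>. k = a ^ \<beta>" if *: "0 < p" "0 < q" "k ^ p = n ^ q" for k p q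
  proof -
    define g where "g = gcd p (\<alpha> * q)"
    define p' where "p' = p div g"
    define q' where "q' = \<alpha> * q div g"
    have g: "0 < g" "p = g * p'" "\<alpha> * q = g * q'"
      using * by (auto simp: g_def p'_def q'_def)
    have cop: "coprime p' q'"
      unfolding p'_def q'_def g_def using * by (intro div_gcd_coprime) auto
    have p': "0 < p'"
      using g * by (cases p') auto
    have "(k ^ p') ^ g = (a ^ q') ^ g"
      using *(3) unfolding a(3) power_mult[symmetric] g(2,3) by (simp add: mult.commute)
    then have eq: "k ^ p' = a ^ q'"
      using g(1) by (simp add: power_eq_iff_eq_base)
    then obtain c where c: "a = c ^ p'"
      using nth_root_of_coprime_power[OF eq cop p'] a(1) by auto
    have "c \<noteq> 0"
      using a(1) c p' by (cases "c = 0") (simp_all add: zero_power)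
    moreover have "c \<noteq> 1"
      using a(1) c by auto
    ultimately have "2 \<le> c"
      by simp
    then have "P c"
      using a c p' unfolding P_def by (auto simp: power_mult[symmetric] intro!: exI[of _ "p' * \<alpha>"])
    then have "a \<le> c"
      by (rule min)
    then have "c ^ p' \<le> c ^ 1"
      using c by simp
    then have "p' \<le> 1"
      using \<open>2 \<le> c\<close> by (subst (asm) power_increasing_iff) auto
    then have "p' = 1"
      using p' by simp
    then show ?thesis
      using eq by auto
  qed
  with a show ?thesis
    by blast
qed

section \<open>Complete prefix codes\<close>

definition sequence_over :: "nat \<Rightarrow> (nat \<Rightarrow> nat) \<Rightarrow> bool" where
  "sequence_over a x \<longleftrightarrow> (\<forall>k. x k < a)"

definition starts_with :: "(nat \<Rightarrow> nat) \<Rightarrow> nat list \<Rightarrow> bool" where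
  "starts_with x w \<longleftrightarrow> (\<forall>k<length w. x k = w ! k)"

lemma starts_with_append:
  "starts_with x (u @ v) \<longleftrightarrow> starts_with x u \<and> starts_with (\<lambda>k. x (length u + k)) v"
  unfolding starts_with_def
proof safe
  fix k assume "\<forall>k<length (u @ v). x k = (u @ v) ! k" "k < length v"
  then show "x (length u + k) = v ! k"
    by (metis add_less_cancel_left length_append nth_append_length_plus)
qed (auto simp: nth_append split: if_splits, metis add_diff_inverse_nat nat_add_left_cancel_less)

text \<open>
  The equality case of Kraft's inequality. Multiplying the equation by \<open>a ^ b\<close>, where \<open>b\<close> is the largest
  length, and reducing modulo \<open>a\<close> shows that the number of indices of length \<open>b > 0\<close> is divisible by \<open>a\<close>.
  Merge \<open>a\<close> of them, the set \<open>J'\<close>, into a single index \<open>i0\<close> of length \<open>b - 1\<close>, and recover their code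
  words from that of \<open>i0\<close> by appending the \<open>a\<close> letters.
\<close>

lemma complete_prefix_code:
  fixes \<beta> :: "'i \<Rightarrow> nat"
  assumes a: "2 \<le> a" and "finite I" and kraft: "(\<Sum>i\<in>I. (1 / real a) ^ \<beta> i) = 1"
  shows "\<exists>c. (\<forall>i\<in>I. length (c i) = \<beta> i \<and> set (c i) \<subseteq> {..<a}) \<and>
    (\<forall>x. sequence_over a x \<longrightarrow> (\<exists>!i. i \<in> I \<and> starts_with x (c i)))"
  using assms(2,3)
proof (induction "card I" arbitrary: I \<beta> rule: less_induct)
  case less
  note fin = \<open>finite I\<close>
  have ne: "I \<noteq> {}"
    using less.prems(2) by auto
  define b where "b = Max (\<beta> ` I)"
  have \<beta>_le: "\<beta> i \<le> b" if "i \<in> I" for i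
    unfolding b_def using that fin by (intro Max_ge) auto
  define J where "J = {i \<in> I. \<beta> i = b}"
  have "b \<in> \<beta> ` I"
    unfolding b_def using fin ne by (intro Max_in) auto
  then have J_ne: "J \<noteq> {}"
    by (auto simp: J_def)
  have J: "finite J" "J \<subseteq> I"
    using fin by (auto simp: J_def)
  have apos: "0 < real a"
    using a by simp
  have total: "(\<Sum>i\<in>I. a ^ (b - \<beta> i)) = a ^ b"
  proof -
    have scaled: "real (a ^ (b - \<beta> i)) = real a ^ b * (1 / real a) ^ \<beta> i" if "i \<in> I" for i
    proof -
      have "real a ^ b = real a ^ (b - \<beta> i) * real a ^ \<beta> i"
        using \<beta>_le[OF that] by (simp add: power_add[symmetric])
      then show ?thesis
        using apos by (simp add: power_one_over)
    qed
    have "real (\<Sum>i\<in>I. a ^ (b - \<beta> i)) = (\<Sum>i\<in>I. real a ^ b * (1 / real a) ^ \<beta> i)"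
      unfolding of_nat_sum by (intro sum.cong refl scaled)
    also have "\<dots> = real a ^ b"
      using less.prems(2) by (simp add: sum_distrib_left[symmetric])
    finally show ?thesis
      by (metis of_nat_eq_iff of_nat_power)
  qed
  show ?case
  proof (cases b)
    case 0
    then have zero: "\<beta> i = 0" if "i \<in> I" for i
      using \<beta>_le[OF that] by simp
    have "card I = 1"
      using total 0 by simp
    then obtain i0 where "I = {i0}"
      by (auto simp: card_1_singleton_iff)
    then show ?thesis
      using zero by (intro exI[of _ "\<lambda>_. []"]) (auto simp: starts_with_def)
  next
    case (Suc b')
    have "(\<Sum>i\<in>I. a ^ (b - \<beta> i)) = (\<Sum>i\<in>J. a ^ (b - \<beta> i)) + (\<Sum>i\<in>I - J. a ^ (b - \<beta> i))"
      using sum.subset_diff[OF J(2) fin, of "\<lambda>i. a ^ (b - \<beta> i)"] by simp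
    also have "(\<Sum>i\<in>J. a ^ (b - \<beta> i)) = card J"
      by (simp add: J_def)
    finally have eq: "card J + (\<Sum>i\<in>I - J. a ^ (b - \<beta> i)) = a ^ b"
      using total by simp
    have "a dvd (\<Sum>i\<in>I - J. a ^ (b - \<beta> i))"
    proof (rule dvd_sum)
      fix i assume "i \<in> I - J"
      then have "b - \<beta> i \<noteq> 0"
        using \<beta>_le[of i] by (auto simp: J_def)
      then show "a dvd a ^ (b - \<beta> i)"
        by (simp add: dvd_power)
    qed
    moreover have "a dvd a ^ b"
      using Suc by simp
    ultimately have "a dvd card J"
      using eq by (metis dvd_add_left_iff)
    moreover have "0 < card J"
      using J J_ne by (simp add: card_gt_0_iff)
    ultimately have "a \<le> card J"
      by (rule dvd_imp_le)
    then obtain J' where J': "J' \<subseteq> J" "card J' = a"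
      by (metis obtain_subset_with_card_n)
    have fin': "finite J'"
      using J' J finite_subset by blast
    obtain h where h: "bij_betw h J' {..<a}"
      using ex_bij_betw_finite_nat[OF fin'] J' by (auto simp: lessThan_atLeast0)
    obtain i0 where i0: "i0 \<in> J'"
      using J'(2) a by (cases "J' = {}") auto
    have J'_I: "J' \<subseteq> I"
      using J' J by blast
    have \<beta>_J': "\<beta> i = Suc b'" if "i \<in> J'" for i
      using that J' Suc by (auto simp: J_def)
    define I' where "I' = insert i0 (I - J')"
    define \<beta>' where "\<beta>' = \<beta>(i0 := b')"
    have finI': "finite I'"
      using fin by (simp add: I'_def)
    have card_I: "card (I - J') + a = card I"
      using J'(2) J'_I fin fin' card_mono[OF fin J'_I] by (simp add: card_Diff_subset)
    then have card: "card I' < card I"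
      using a fin i0 by (simp add: I'_def)
    have "(\<Sum>i\<in>I'. (1 / real a) ^ \<beta>' i) = (1 / real a) ^ b' + (\<Sum>i\<in>I - J'. (1 / real a) ^ \<beta> i)"
    proof -
      have "(\<Sum>i\<in>I - J'. (1 / real a) ^ \<beta>' i) = (\<Sum>i\<in>I - J'. (1 / real a) ^ \<beta> i)"
        using i0 by (intro sum.cong) (auto simp: \<beta>'_def)
      then show ?thesis
        using fin i0 by (simp add: I'_def \<beta>'_def)
    qed
    also have "(1 / real a) ^ b' = (\<Sum>i\<in>J'. (1 / real a) ^ \<beta> i)"
      using \<beta>_J' J'(2) apos by simp
    also have "(\<Sum>i\<in>J'. (1 / real a) ^ \<beta> i) + (\<Sum>i\<in>I - J'. (1 / real a) ^ \<beta> i) = 1"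
      using sum.subset_diff[OF J'_I fin, of "\<lambda>i. (1 / real a) ^ \<beta> i"] less.prems(2) by simp
    finally have kraft': "(\<Sum>i\<in>I'. (1 / real a) ^ \<beta>' i) = 1" .
    obtain c' where c': "\<And>i. i \<in> I' \<Longrightarrow> length (c' i) = \<beta>' i \<and> set (c' i) \<subseteq> {..<a}"
      "\<And>x. sequence_over a x \<Longrightarrow> \<exists>!i. i \<in> I' \<and> starts_with x (c' i)"
      using less.hyps[OF card finI' kraft'] by blast
    define c where "c i = (if i \<in> J' then c' i0 @ [h i] else c' i)" for i
    have h_lt: "h i < a" if "i \<in> J'" for i
      using h that by (auto simp: bij_betw_def)
    have c_J': "starts_with x (c i) \<longleftrightarrow> starts_with x (c' i0) \<and> x b' = h i" if "i \<in> J'" for x i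
    proof -
      have "length (c' i0) = b'"
        using c'(1)[of i0] by (simp add: I'_def \<beta>'_def)
      then show ?thesis
        using that by (simp add: c_def starts_with_append) (simp add: starts_with_def)
    qed
    show ?thesis
    proof (intro exI[of _ c] conjI ballI allI impI)
      fix i assume i: "i \<in> I"
      have "length (c i) = \<beta> i \<and> set (c i) \<subseteq> {..<a}"
      proof (cases "i \<in> J'")
        case True
        then show ?thesis
          using c'(1)[of i0] h_lt[of i] \<beta>_J'[of i] by (simp add: c_def I'_def \<beta>'_def)
      next
        case False
        then have "i \<in> I'" "i \<noteq> i0"
          using i i0 by (auto simp: I'_def)
        then show ?thesis
          using c'(1)[of i] False by (simp add: c_def \<beta>'_def)
      qed
      then show "length (c i) = \<beta> i" "set (c i) \<subseteq> {..<a}"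
        by simp_all
    next
      fix x assume x: "sequence_over a x"
      obtain k where k: "k \<in> I'" "starts_with x (c' k)"
        and uniq: "\<And>k'. k' \<in> I' \<Longrightarrow> starts_with x (c' k') \<Longrightarrow> k' = k"
        using c'(2)[OF x] by blast
      show "\<exists>!i. i \<in> I \<and> starts_with x (c i)"
      proof (cases "k = i0")
        case True
        have "x b' \<in> h ` J'"
          using h x by (auto simp: bij_betw_def sequence_over_def)
        then obtain i where i: "i \<in> J'" "h i = x b'"
          by force
        show ?thesis
        proof (intro ex1I[of _ i] conjI)
          show "i \<in> I" "starts_with x (c i)"
            using i J'_I c_J'[OF i(1)] k True by auto
          fix i' assume i': "i' \<in> I \<and> starts_with x (c i')"
          have "i' \<in> J'"
          proof (rule ccontr)
            assume "i' \<notin> J'"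
            then have "i' \<in> I'" "starts_with x (c' i')" "i' \<noteq> i0"
              using i' i0 by (auto simp: I'_def c_def)
            then show False
              using uniq True by blast
          qed
          then show "i' = i"
            using c_J' i i' h by (auto simp: bij_betw_def inj_on_def)
        qed
      next
        case False
        then have kI: "k \<in> I" "k \<notin> J'"
          using k by (auto simp: I'_def)
        show ?thesis
        proof (intro ex1I[of _ k] conjI)
          show "k \<in> I" "starts_with x (c k)"
            using kI k by (auto simp: c_def)
          fix i' assume i': "i' \<in> I \<and> starts_with x (c i')"
          show "i' = k"
          proof (cases "i' \<in> J'")
            case True
            then have "starts_with x (c' i0)"
              using c_J' i' by blast
            then show ?thesis
              using uniq[of i0] False by (simp add: I'_def)
          next
            case notin: False
            then have "i' \<in> I'" "starts_with x (c' i')"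
              using i' by (auto simp: I'_def c_def)
            then show ?thesis
              by (rule uniq)
          qed
        qed
      qed
    qed
  qed
qed

section \<open>Regular trees of sets\<close>

text \<open>
  A set with this structure is a bi-Lipschitz copy of the space of sequences over \<open>a\<close> letters, metrised
  by \<open>\<rho>\<close> to the length of the longest common prefix. The metric space of sequences itself never has to be
  introduced: two such sets are compared directly through their trees.
\<close>

locale cantor_tree =
  fixes a :: nat and \<rho> C :: real and X :: "'a::metric_space set" and S :: "nat list \<Rightarrow> 'a set"
  assumes \<rho>: "0 < \<rho>" "\<rho> < 1" and C: "0 < C"
    and S_Nil: "S [] = X"
    and S_compact: "set w \<subseteq> {..<a} \<Longrightarrow> compact (S w)"
    and S_nonempty: "set w \<subseteq> {..<a} \<Longrightarrow> S w \<noteq> {}"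
    and S_children: "set w \<subseteq> {..<a} \<Longrightarrow> S w = (\<Union>i\<in>{..<a}. S (w @ [i]))"
    and S_small: "set w \<subseteq> {..<a} \<Longrightarrow> x \<in> S w \<Longrightarrow> y \<in> S w \<Longrightarrow> dist x y \<le> C * \<rho> ^ length w"
    and S_separated: "set w \<subseteq> {..<a} \<Longrightarrow> i < a \<Longrightarrow> j < a \<Longrightarrow> i \<noteq> j \<Longrightarrow>
      x \<in> S (w @ [i]) \<Longrightarrow> y \<in> S (w @ [j]) \<Longrightarrow> \<rho> ^ length w \<le> C * dist x y"
begin

lemma S_append: "set (w @ v) \<subseteq> {..<a} \<Longrightarrow> S (w @ v) \<subseteq> S w"
proof (induction v rule: rev_induct)
  case (snoc i v)
  have "S ((w @ v) @ [i]) \<subseteq> S (w @ v)"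
    using snoc.prems by (subst (2) S_children) auto
  with snoc show ?case
    by auto
qed simp

lemma S_disjoint:
  assumes "set w \<subseteq> {..<a}" "set w' \<subseteq> {..<a}" "length w = length w'" "x \<in> S w" "x \<in> S w'"
  shows "w = w'"
proof (rule ccontr)
  assume "w \<noteq> w'"
  from same_length_different[OF this assms(3)] obtain u i j v v'
    where w: "w = u @ [i] @ v" "w' = u @ [j] @ v'" and "i \<noteq> j"
    by blast
  have "S w \<subseteq> S (u @ [i])" "S w' \<subseteq> S (u @ [j])"
    using S_append[of "u @ [i]" v] S_append[of "u @ [j]" v'] assms(1,2) w by auto
  then have "\<rho> ^ length u \<le> C * dist x x"
    using assms w \<open>i \<noteq> j\<close> by (intro S_separated[of u i j]) auto
  then show False
    using zero_less_power[OF \<rho>(1), of "length u"] by simp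
qed

text \<open>
  Two points lying in a common set of every generation have distance at most \<open>C * \<rho> ^ k\<close> for all \<open>k\<close>.
\<close>

lemma ex_branch:
  assumes "x \<in> X" "y \<in> X" "x \<noteq> y"
  shows "\<exists>w i j. set w \<subseteq> {..<a} \<and> i < a \<and> j < a \<and> i \<noteq> j \<and> x \<in> S (w @ [i]) \<and> y \<in> S (w @ [j])"
proof (rule ccontr)
  assume no: "\<not> ?thesis"
  have common: "\<exists>w. set w \<subseteq> {..<a} \<and> length w = k \<and> x \<in> S w \<and> y \<in> S w" for k
  proof (induction k)
    case 0
    then show ?case
      using assms by (simp add: S_Nil)
  next
    case (Suc k)
    then obtain w where w: "set w \<subseteq> {..<a}" "length w = k" "x \<in> S w" "y \<in> S w"
      by blast
    obtain i where i: "i < a" "x \<in> S (w @ [i])"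
      using w(3) S_children[OF w(1)] by auto
    obtain j where j: "j < a" "y \<in> S (w @ [j])"
      using w(4) S_children[OF w(1)] by auto
    have "i = j"
      using no w(1) i j by blast
    then show ?case
      using w i j by (intro exI[of _ "w @ [i]"]) auto
  qed
  obtain k where k: "\<rho> ^ k < dist x y / C"
    using real_arch_pow_inv[of "dist x y / C" \<rho>] assms \<rho> C by auto
  obtain w where "set w \<subseteq> {..<a}" "length w = k" "x \<in> S w" "y \<in> S w"
    using common by blast
  then have "dist x y \<le> C * \<rho> ^ k"
    using S_small by blast
  then show False
    using k C by (simp add: field_simps)
qed

primrec path :: "'a \<Rightarrow> nat \<Rightarrow> nat list" where
  "path x 0 = []"
| "path x (Suc k) = path x k @ [SOME i. i < a \<and> x \<in> S (path x k @ [i])]"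

lemma path:
  assumes "x \<in> X"
  shows "set (path x k) \<subseteq> {..<a} \<and> length (path x k) = k \<and> x \<in> S (path x k)"
proof (induction k)
  case 0
  then show ?case
    using assms by (simp add: S_Nil)
next
  case (Suc k)
  then have "\<exists>i. i < a \<and> x \<in> S (path x k @ [i])"
    using S_children[of "path x k"] by auto
  from someI_ex[OF this] Suc show ?case
    by simp
qed

end

locale cantor_tree_pair = X: cantor_tree a \<rho> C X S + Y: cantor_tree a \<rho> C' Y S'
  for a \<rho> C and X :: "'a::heine_borel set" and S and C' and Y :: "'b::heine_borel set" and S'
begin

text \<open>
  \<open>R x y\<close> says that \<open>x\<close> and \<open>y\<close> have the same address. The relation is symmetric in the two trees, so
  totality and the Lipschitz bound are needed in one direction only.
\<close>

definition R :: "'a \<Rightarrow> 'b \<Rightarrow> bool" where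
  "R x y \<longleftrightarrow> (\<forall>w. set w \<subseteq> {..<a} \<longrightarrow> (x \<in> S w \<longleftrightarrow> y \<in> S' w))"

text \<open>
  The sets of \<open>Y\<close> along the address of \<open>x\<close> are nested, compact and non-empty.
\<close>

lemma ex_R: assumes x: "x \<in> X" shows "\<exists>y\<in>Y. R x y"
proof -
  define p where "p = X.path x"
  have p: "set (p k) \<subseteq> {..<a}" "length (p k) = k" "x \<in> S (p k)" for k
    using X.path[OF x, of k] by (simp_all add: p_def)
  have Suc: "S' (p (Suc k)) \<subseteq> S' (p k)" for k
  proof -
    have "p (Suc k) = p k @ [last (p (Suc k))]"
      by (simp add: p_def)
    then show ?thesis
      using Y.S_append[of "p k" "[last (p (Suc k))]"] p(1)[of "Suc k"] by simp
  qed
  have "\<Inter> (range (\<lambda>k. S' (p k))) \<noteq> {}"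
  proof (rule compact_nest)
    show "S' (p l) \<subseteq> S' (p k)" if "k \<le> l" for k l
      using lift_Suc_antimono_le[of "\<lambda>k. S' (p k)"] Suc that by blast
  qed (use p(1) in \<open>auto intro!: Y.S_compact Y.S_nonempty simp del: subset_iff\<close>)
  then obtain y where y: "y \<in> S' (p k)" for k
    by auto
  have "R x y"
    unfolding R_def
  proof (intro allI impI)
    fix w assume w: "set w \<subseteq> {..<a}"
    have "x \<in> S w \<longleftrightarrow> w = p (length w)"
      using X.S_disjoint[OF w p(1), of "length w" x] p by metis
    moreover have "y \<in> S' w \<longleftrightarrow> w = p (length w)"
      using Y.S_disjoint[OF w p(1), of "length w" y] p(2) y by metis
    ultimately show "x \<in> S w \<longleftrightarrow> y \<in> S' w"
      by simp
  qed
  moreover have "y \<in> Y"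
    using y[of 0] by (simp add: p_def Y.S_Nil)
  ultimately show ?thesis
    by blast
qed

lemma dist_R:
  assumes "x \<in> X" "x' \<in> X" "y \<in> Y" "y' \<in> Y" "R x y" "R x' y'"
  shows "dist y y' \<le> C' * C * dist x x'"
proof (cases "y = y'")
  case True
  then show ?thesis
    using X.C Y.C by simp
next
  case False
  then obtain w i j where w: "set w \<subseteq> {..<a}" "i < a" "j < a" "i \<noteq> j"
      and y: "y \<in> S' (w @ [i])" "y' \<in> S' (w @ [j])"
    using Y.ex_branch assms by blast
  have x: "x \<in> S (w @ [i])" "x' \<in> S (w @ [j])"
    using assms(5,6) y w unfolding R_def by auto
  have "y \<in> S' w" "y' \<in> S' w"
    using y Y.S_children[OF w(1)] w by auto
  then have "dist y y' \<le> C' * \<rho> ^ length w"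
    by (rule Y.S_small[OF w(1)])
  also have "\<dots> \<le> C' * (C * dist x x')"
    using Y.C X.S_separated[OF w x] by (intro mult_left_mono) auto
  finally show ?thesis
    by simp
qed

end

sublocale cantor_tree_pair \<subseteq> swap: cantor_tree_pair a \<rho> C' Y S' C X S ..

context cantor_tree_pair
begin

lemma swap_R: "swap.R y x \<longleftrightarrow> R x y"
  unfolding swap.R_def R_def by blast

lemma lipschitz_equivalent: "lipschitz_equivalent X Y"
proof -
  obtain g where g: "\<And>x. x \<in> X \<Longrightarrow> g x \<in> Y \<and> R x (g x)"
    using ex_R by metis
  have upper: "dist (g x) (g x') \<le> C' * C * dist x x'" if "x \<in> X" "x' \<in> X" for x x'
    using dist_R g that by blast
  have lower: "dist x x' \<le> C' * C * dist (g x) (g x')" if "x \<in> X" "x' \<in> X" for x x'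
    using swap.dist_R[of "g x" "g x'" x x'] g[OF that(1)] g[OF that(2)] that
    by (simp add: swap_R mult.commute)
  have CC: "0 < C' * C"
    using X.C Y.C by simp
  have "bij_betw g X Y"
    unfolding bij_betw_def
  proof (intro conjI equalityI subsetI)
    show "inj_on g X"
    proof (rule inj_onI)
      fix x x' assume "x \<in> X" "x' \<in> X" "g x = g x'"
      then show "x = x'"
        using lower[of x x'] by simp
    qed
    fix y assume y: "y \<in> Y"
    then obtain x where x: "x \<in> X" "R x y"
      using swap.ex_R[OF y] by (auto simp: swap_R)
    have "dist y (g x) \<le> C' * C * dist x x"
      using g[OF x(1)] x y by (intro dist_R) auto
    then show "y \<in> g ` X"
      using x(1) by simp
  qed (use g in blast)
  moreover have "inverse (C' * C) * dist x x' \<le> dist (g x) (g x')" if "x \<in> X" "x' \<in> X" for x x'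
    using lower[OF that] X.C Y.C by (simp add: field_simps)
  ultimately show ?thesis
    unfolding lipschitz_equivalent_def using upper CC by blast
qed

end

section \<open>The tree of a dust-like set with commensurable ratios\<close>

context dust_ifs
begin

text \<open>
  Let \<open>code v\<close> be the concatenation of the code words of the letters of \<open>v\<close>. As \<open>r i = \<rho> ^ \<beta> i\<close>, the
  ratio of the cylinder of \<open>v\<close> is \<open>\<rho>\<close> to the length of \<open>code v\<close>. The set attached to a word \<open>w\<close> over
  \<open>a\<close> letters consists of the points whose address has a code beginning with \<open>w\<close>. Code words are
  non-empty, so the first \<open>length w\<close> letters of an address decide this and the set is a finite union of
  cylinders; it is non-empty by completeness of the code. If two addresses branch after \<open>u\<close>, their codes
  agree along \<open>code u\<close> and branch at most \<open>b = max \<beta>\<close> letters later, since distinct code words are not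
  prefixes of each other. This compares diameters and gaps with \<open>\<rho> ^ length w\<close>.
\<close>

lemma ex_cantor_tree:
  assumes a: "2 \<le> a" and \<rho>: "0 < \<rho>" "\<rho> < 1"
    and r_\<rho>: "\<And>i. i \<in> {1..n} \<Longrightarrow> r i = \<rho> ^ \<beta> i"
    and kraft: "(\<Sum>i\<in>{1..n}. (1 / real a) ^ \<beta> i) = 1"
  shows "\<exists>C S. cantor_tree a \<rho> C K S"
proof -
  obtain c where c: "\<forall>i\<in>{1..n}. length (c i) = \<beta> i \<and> set (c i) \<subseteq> {..<a}"
    "\<forall>x. sequence_over a x \<longrightarrow> (\<exists>!i. i \<in> {1..n} \<and> starts_with x (c i))"
    using complete_prefix_code[OF a finite_atLeastAtMost kraft] by blast
  have c_len: "length (c i) = \<beta> i" and c_set: "set (c i) \<subseteq> {..<a}" if "i \<in> {1..n}" for i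
    using c(1) that by blast+
  have c_ex1: "\<exists>!i. i \<in> {1..n} \<and> starts_with x (c i)" if "sequence_over a x" for x
    using c(2) that by blast
  define code where "code v = concat (map c v)" for v
  have code_simps [simp]: "code [] = []" "code (i # v) = c i @ code v" "code (u @ v) = code u @ code v" for i u v
    by (simp_all add: code_def)
  have \<beta>_pos: "1 \<le> \<beta> i" if "i \<in> {1..n}" for i
    using r_bounds(2)[OF that] r_\<rho>[OF that] by (cases "\<beta> i") auto
  have code_len: "length v \<le> length (code v)" if "set v \<subseteq> {1..n}" for v
    using that
  proof (induction v)
    case (Cons i v)
    then show ?case
      using \<beta>_pos[of i] c_len[of i] by auto
  qed simp
  have code_set: "set (code v) \<subseteq> {..<a}" if "set v \<subseteq> {1..n}" for v
    using that c_set unfolding code_def by fastforce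
  have ratio_code: "ratio v = \<rho> ^ length (code v)" if "set v \<subseteq> {1..n}" for v
    using that
  proof (induction v)
    case (Cons i v)
    then show ?case
      using r_\<rho>[of i] c_len[of i] by (auto simp: power_add)
  qed simp
  have code_ex: "\<exists>v\<in>words n k. starts_with x (code v)" if "sequence_over a x" for x k
    using that
  proof (induction k arbitrary: x)
    case 0
    then show ?case
      by (simp add: starts_with_def)
  next
    case (Suc k)
    obtain i where i: "i \<in> {1..n}" "starts_with x (c i)"
      using c_ex1[OF Suc.prems] by blast
    have "sequence_over a (\<lambda>k. x (length (c i) + k))"
      using Suc.prems by (simp add: sequence_over_def)
    then obtain v where "v \<in> words n k" "starts_with (\<lambda>k. x (length (c i) + k)) (code v)"
      using Suc.IH by blast
    then show ?case
      using i by (intro bexI[of _ "i # v"]) (auto simp: starts_with_append words_def)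
  qed
  \<comment> \<open>Completeness of the code speaks of infinite sequences; finite words are padded with zeros.\<close>
  define seq where "seq w k = (if k < length w then w ! k else 0)" for w :: "nat list" and k
  have seq: "sequence_over a (seq w)" if "set w \<subseteq> {..<a}" for w
    using that a nth_mem[of _ w] unfolding sequence_over_def seq_def by fastforce
  have seq_prefix: "starts_with (seq w) u" if "prefix u w" for u w
    using that by (auto simp: starts_with_def seq_def prefix_def nth_append)
  have prefix_seq: "prefix w u" if "starts_with (seq w) u" "length w \<le> length u" for u w
  proof -
    have "take (length w) u = w"
    proof (rule nth_equalityI)
      fix i assume "i < length (take (length w) u)"
      then have "i < length w" "i < length u"
        by simp_all
      moreover from this have "seq w i = u ! i"
        using that(1) by (simp add: starts_with_def)
      ultimately show "take (length w) u ! i = w ! i"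
        by (simp add: seq_def)
    qed (use that(2) in simp)
    then show ?thesis
      by (metis take_is_prefix)
  qed
  define b where "b = Max (\<beta> ` {1..n})"
  have \<beta>_le: "\<beta> i \<le> b" if "i \<in> {1..n}" for i
    unfolding b_def using that by (intro Max_ge) auto
  \<comment> \<open>Beyond this length, \<open>w\<close> would contain both code words \<open>c i\<close> and \<open>c j\<close> right after \<open>code u\<close>.\<close>
  have diverge: "length w \<le> length (code u) + b"
    if w: "prefix w (code (u @ i # v))" "prefix w (code (u @ j # v'))" and "i \<noteq> j"
      and sub: "set (u @ i # v) \<subseteq> {1..n}" "set (u @ j # v') \<subseteq> {1..n}" for w u i j v v'
  proof (rule ccontr)
    assume long: "\<not> ?thesis"
    have ij: "i \<in> {1..n}" "j \<in> {1..n}"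
      using sub by auto
    define z where "z = drop (length (code u)) w"
    have w_eq: "w = code u @ z"
      using w(1) long prefix_length_prefix[of "code u" "code (u @ i # v)" w] by (auto simp: z_def prefix_def)
    have z: "prefix z (c i @ code v)" "prefix z (c j @ code v')"
      using w unfolding w_eq by simp_all
    have len: "length (c i) \<le> length z" "length (c j) \<le> length z"
      using long \<beta>_le[OF ij(1)] \<beta>_le[OF ij(2)] c_len[OF ij(1)] c_len[OF ij(2)] by (auto simp: w_eq)
    have "prefix (c i) z" "prefix (c j) z"
      using prefix_length_prefix[OF _ z(1) len(1)] prefix_length_prefix[OF _ z(2) len(2)] by simp_all
    then have "starts_with (seq z) (c i)" "starts_with (seq z) (c j)"
      by (simp_all add: seq_prefix)
    moreover have "sequence_over a (seq z)"
    proof (rule seq)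
      have "set z \<subseteq> set (code (u @ i # v))"
        using set_mono_prefix[OF w(1)] w_eq by auto
      then show "set z \<subseteq> {..<a}"
        using code_set[OF sub(1)] by blast
    qed
    ultimately show False
      using c_ex1 ij \<open>i \<noteq> j\<close> by blast
  qed
  define V where "V w = {v \<in> words n (length w). prefix w (code v)}" for w
  define S where "S w = (\<Union>v\<in>V w. cyl v)" for w
  define C where "C = max (diameter K / \<rho> ^ b) (1 / gap)"
  have "cantor_tree a \<rho> C K S"
  proof
    show "0 < \<rho>" "\<rho> < 1"
      by (fact \<rho>)+
    show "0 < C"
      using gap_pos by (simp add: C_def less_max_iff_disj)
    show "S [] = K"
      by (simp add: S_def V_def)
  next
    fix w assume w: "set w \<subseteq> {..<a}"
    show "compact (S w)"
      unfolding S_def by (intro compact_UN) (auto simp: V_def dest!: wordsD intro: cyl_compact)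
    obtain v where v: "v \<in> words n (length w)" "starts_with (seq w) (code v)"
      using code_ex[OF seq[OF w]] by blast
    then have "v \<in> V w"
      using prefix_seq[OF v(2)] code_len[OF wordsD[OF v(1)]] by (simp add: V_def words_def)
    then show "S w \<noteq> {}"
      using cyl_nonempty by (auto simp: S_def)
    show "S w = (\<Union>i\<in>{..<a}. S (w @ [i]))"
    proof (intro equalityI subsetI)
      fix x assume "x \<in> S w"
      then obtain v where v: "v \<in> words n (length w)" "prefix w (code v)" "x \<in> cyl v"
        by (auto simp: S_def V_def)
      obtain k where k: "k \<in> {1..n}" "x \<in> cyl (v @ [k])"
        using v(3) cyl_snoc[of v] by blast
      have vk: "v @ [k] \<in> words n (length (w @ [i]))" for i
        using v(1) k(1) by (simp add: words_def)
      obtain z where z: "code (v @ [k]) = w @ z"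
        using v(2) by (auto simp: prefix_def)
      have "length w < length (code (v @ [k]))"
        using code_len[OF wordsD[OF vk]] vk[of 0] by (simp add: words_def del: code_simps)
      then obtain i z' where i: "z = i # z'"
        using z by (cases z) auto
      have "i \<in> set (code (v @ [k]))"
        by (simp add: z i del: code_simps)
      then have "i < a"
        using code_set[OF wordsD[OF vk]] by blast
      moreover have "v @ [k] \<in> V (w @ [i])"
        unfolding V_def using vk z i by (simp add: prefix_def del: code_simps)
      ultimately show "x \<in> (\<Union>i\<in>{..<a}. S (w @ [i]))"
        using k(2) by (auto simp: S_def)
    next
      fix x assume "x \<in> (\<Union>i\<in>{..<a}. S (w @ [i]))"
      then obtain i v where i: "v \<in> words n (Suc (length w))" "prefix (w @ [i]) (code v)" "x \<in> cyl v"
        by (auto simp: S_def V_def)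
      then obtain v' k where v: "v = v' @ [k]"
        by (cases v rule: rev_cases) (auto simp: words_def)
      have v': "v' \<in> words n (length w)" "set [k] \<subseteq> {1..n}"
        using i(1) v by (auto simp: words_def)
      have "prefix w (code v)"
        using i(2) by (rule append_prefixD)
      moreover have "prefix (code v') (code v)"
        by (simp add: v)
      ultimately have "prefix w (code v')"
        using code_len[OF wordsD[OF v'(1)]] v'(1) by (auto simp: words_def intro: prefix_length_prefix)
      moreover have "x \<in> cyl v'"
        using cyl_append_subset[OF v'(2), of v'] i(3) v by blast
      ultimately show "x \<in> S w"
        using v' by (auto simp: S_def V_def)
    qed
  next
    fix w x y assume w: "set w \<subseteq> {..<a}" and x: "x \<in> S w" and y: "y \<in> S w"
    obtain v where v: "v \<in> words n (length w)" "prefix w (code v)" "x \<in> cyl v"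
      using x by (auto simp: S_def V_def)
    obtain v' where v': "v' \<in> words n (length w)" "prefix w (code v')" "y \<in> cyl v'"
      using y by (auto simp: S_def V_def)
    have "\<exists>u. set u \<subseteq> {1..n} \<and> x \<in> cyl u \<and> y \<in> cyl u \<and> length w \<le> length (code u) + b"
    proof (cases "v = v'")
      case True
      then show ?thesis
        using v v' wordsD[OF v(1)] prefix_length_le[OF v(2)] by (intro exI[of _ v]) auto
    next
      case False
      have "length v = length v'"
        using v v' by (simp add: words_def)
      from same_length_different[OF False this] obtain u i j v1 v2
        where eq: "v = u @ [i] @ v1" "v' = u @ [j] @ v2" and "i \<noteq> j"
        by blast
      have sub: "set (u @ i # v1) \<subseteq> {1..n}" "set (u @ j # v2) \<subseteq> {1..n}"
        using wordsD[OF v(1)] wordsD[OF v'(1)] by (simp_all add: eq)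
      have "length w \<le> length (code u) + b"
        using v(2) v'(2) by (intro diverge[OF _ _ \<open>i \<noteq> j\<close> sub]) (simp_all add: eq)
      moreover have "x \<in> cyl u" "y \<in> cyl u"
        using cyl_append_subset[of "i # v1" u] cyl_append_subset[of "j # v2" u] v(3) v'(3) sub
        by (auto simp: eq)
      ultimately show ?thesis
        using sub(1) by (intro exI[of _ u]) auto
    qed
    then obtain u where u: "set u \<subseteq> {1..n}" "x \<in> cyl u" "y \<in> cyl u" "length w \<le> length (code u) + b"
      by blast
    have "dist x y \<le> \<rho> ^ length (code u) * diameter K"
      using dist_cyl_le[OF u(1-3)] by (simp add: ratio_code[OF u(1)])
    also have "\<dots> = \<rho> ^ (length (code u) + b) * (diameter K / \<rho> ^ b)"
      using \<rho> by (simp add: power_add)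
    also have "\<dots> \<le> \<rho> ^ length w * C"
      using \<rho> u(4) diameter_K_nonneg by (intro mult_mono power_decreasing) (auto simp: C_def)
    finally show "dist x y \<le> C * \<rho> ^ length w"
      by (simp add: mult.commute)
  next
    fix w i j x y
    assume w: "set w \<subseteq> {..<a}" and ij: "i < a" "j < a" "i \<noteq> j"
      and x: "x \<in> S (w @ [i])" and y: "y \<in> S (w @ [j])"
    obtain v where v: "v \<in> words n (Suc (length w))" "prefix (w @ [i]) (code v)" "x \<in> cyl v"
      using x by (auto simp: S_def V_def)
    obtain v' where v': "v' \<in> words n (Suc (length w))" "prefix (w @ [j]) (code v')" "y \<in> cyl v'"
      using y by (auto simp: S_def V_def)
    have clash: False if "prefix (w @ [i]) z" "prefix (w @ [j]) z" for z
      using that ij(3) by (auto simp: prefix_def)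
    have False: "v \<noteq> v'"
      using clash v(2) v'(2) by blast
    have "length v = length v'"
      using v v' by (simp add: words_def)
    from same_length_different[OF False this] obtain u k l v1 v2
      where eq: "v = u @ [k] @ v1" "v' = u @ [l] @ v2" and "k \<noteq> l"
      by blast
    have sub: "set (u @ k # v1) \<subseteq> {1..n}" "set (u @ l # v2) \<subseteq> {1..n}"
      using wordsD[OF v(1)] wordsD[OF v'(1)] by (simp_all add: eq)
    have u_le: "length (code u) \<le> length w"
    proof (rule ccontr)
      assume "\<not> ?thesis"
      then have "prefix (w @ [i]) (code u)" "prefix (w @ [j]) (code u)"
        using prefix_length_prefix[OF v(2), of "code u"] prefix_length_prefix[OF v'(2), of "code u"]
        by (simp_all add: eq)
      then show False
        by (rule clash)
    qed
    have su: "set u \<subseteq> {1..n}"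
      using sub by simp
    have "\<rho> ^ length w \<le> \<rho> ^ length (code u)"
      using u_le \<rho> by (intro power_decreasing) auto
    also have "gap * \<rho> ^ length (code u) \<le> dist x y"
      using branch_separation[OF sub \<open>k \<noteq> l\<close>] v(3) v'(3) by (simp add: eq ratio_code[OF su])
    then have "\<rho> ^ length (code u) \<le> 1 / gap * dist x y"
      using gap_pos by (simp add: field_simps)
    also have "\<dots> \<le> C * dist x y"
      by (intro mult_right_mono) (auto simp: C_def)
    finally show "\<rho> ^ length w \<le> C * dist x y" .
  qed
  then show ?thesis
    by blast
qed

end

section \<open>Lipschitz equivalence\<close>

context dust_ifs
begin

text \<open>
  The scale \<open>\<rho> = a powr (- 1 / s)\<close> is chosen so that \<open>\<rho> powr s = 1 / a\<close>: then prescribed weights are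
  prescribed ratios, and \<open>pressure s = 1\<close> is Kraft's equation. It depends on \<open>a\<close> and \<open>s\<close> only, so \<open>K\<close> and
  \<open>F\<close> obtain trees of the same scale.
\<close>

lemma ex_cantor_tree_of_weights:
  assumes a: "2 \<le> a" and s: "0 < s" "pressure s = 1"
    and w: "\<And>i. i \<in> {1..n} \<Longrightarrow> r i powr s = (1 / real a) ^ \<beta> i"
  shows "\<exists>C S. cantor_tree a (real a powr (- 1 / s)) C K S"
proof (rule ex_cantor_tree[OF a])
  show "0 < real a powr (- 1 / s)"
    using a by simp
  show "real a powr (- 1 / s) < 1"
    using a s powr_less_mono[of "- 1 / s" 0 "real a"] by simp
  show "r i = (real a powr (- 1 / s)) ^ \<beta> i" if "i \<in> {1..n}" for i
  proof -
    have "r i = (r i powr s) powr (1 / s)"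
      using r_bounds(1)[OF that] s by (simp add: powr_powr)
    also have "r i powr s = real a powr (- real (\<beta> i))"
      using a by (simp add: w[OF that] powr_minus powr_realpow power_one_over inverse_eq_divide)
    also have "\<dots> powr (1 / s) = (real a powr (- 1 / s)) powr real (\<beta> i)"
      by (simp add: powr_powr)
    also have "\<dots> = (real a powr (- 1 / s)) ^ \<beta> i"
      using a by (intro powr_realpow) simp
    finally show ?thesis .
  qed
  show "(\<Sum>i\<in>{1..n}. (1 / real a) ^ \<beta> i) = 1"
    using s(2) w by (simp add: pressure_def)
qed

end


theorem corollary1p4:
  fixes K F :: "(real ^ 'd) set" and s :: real
  assumes "dust_like K" and "dust_like F"
    and "hausdorff_dim K = ereal s" and "hausdorff_dim F = ereal s"
    and "homogeneous_dust_like K"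
    and "\<exists>f L. L-lipschitz_on K f \<and> f ` K \<subseteq> F \<and> hausdorff_measure s (f ` K) > 0"
  shows "lipschitz_equivalent K F"
proof -
  obtain n r \<phi> where K: "dust_like_ifs n r \<phi> K"
    and hom: "\<forall>i\<in>{1..n}. \<forall>j\<in>{1..n}. r i = r j"
    using assms(5) unfolding homogeneous_dust_like_def by blast
  obtain m t \<psi> where F: "dust_like_ifs m t \<psi> F"
    using assms(2) unfolding dust_like_def by blast
  obtain f L where lip: "L-lipschitz_on K f" and sub: "f ` K \<subseteq> F"
    and pos: "0 < hausdorff_measure s (f ` K)"
    using assms(6) by blast
  interpret K: dust_ifs n r \<phi> K by unfold_locales (rule K)
  interpret F: dust_ifs m t \<psi> F by unfold_locales (rule F)
  have s: "0 < s" "K.pressure s = 1" "F.pressure s = 1"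
    using K.hausdorff_dim_pressure[OF assms(3)] F.hausdorff_dim_pressure[OF assms(4)] by simp_all
  have one: "1 \<in> {1..n}"
    using K.two_le_n by simp
  have r_eq: "r i = r 1" if "i \<in> {1..n}" for i
    using hom one that by blast
  have "K.pressure s = (\<Sum>i\<in>{1..n}. r 1 powr s)"
    unfolding K.pressure_def by (intro sum.cong refl arg_cong[of _ _ "\<lambda>x. x powr s"] r_eq)
  then have r1: "r 1 powr s = 1 / n"
    using s(2) K.two_le_n by (simp add: field_simps)
  interpret lipschitz_pair n r \<phi> K m t \<psi> F f L "r 1" s
    by unfold_locales (fact lip, fact sub, erule r_eq, fact s(1), fact r1, fact s(3))
  obtain a \<alpha> where a: "2 \<le> a" and n: "n = a ^ \<alpha>"
    and base: "\<And>k p e. 0 < p \<Longrightarrow> 0 < e \<Longrightarrow> k ^ p = n ^ e \<Longrightarrow> \<exists>\<beta>. k = a ^ \<beta>"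
    using common_base[OF K.two_le_n] by metis
  \<comment> \<open>The positive measure of \<open>f ` K\<close> becomes the positive lower bound \<open>h / D\<close> on its masses.\<close>
  define D where "D = diameter F powr s"
  define h where "h = enn2real (hausdorff_measure s (f ` K))"
  have le: "hausdorff_measure s (f ` K) \<le> ennreal (D * F.mass s (f ` K) k)" for k
    unfolding D_def using s sub by (intro F.hausdorff_measure_le_mass) auto
  have h_pos: "0 < h"
    unfolding h_def using pos le[of 0] by (simp add: enn2real_positive_iff le_less_trans)
  have h_le: "h \<le> D * F.mass s (f ` K) k" for k
    unfolding h_def using le[of k] F.mass_nonneg by (intro enn2real_leI) (auto simp: D_def)
  have D: "0 < D"
    using h_pos h_le[of 0] unfolding D_def by (cases "diameter F powr s = 0") auto
  have mass: "h / D \<le> F.mass s (f ` K) k" for k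
    using h_le[of k] D by (simp add: field_simps)
  have "\<exists>\<beta>. t j powr s = (1 / real a) ^ \<beta>" if j: "j \<in> {1..m}" for j
  proof -
    obtain k p e where kpe: "0 < p" "0 < e" "k ^ p = n ^ e" "t j powr s = 1 / real k"
      using weight_is_integer_reciprocal[OF _ mass j] h_pos D by auto
    obtain \<beta> where "k = a ^ \<beta>"
      using base[OF kpe(1-3)] by blast
    then show ?thesis
      using kpe(4) by (auto simp: power_one_over)
  qed
  then obtain \<beta> where \<beta>: "\<And>j. j \<in> {1..m} \<Longrightarrow> t j powr s = (1 / real a) ^ \<beta> j"
    by metis
  have "r i powr s = (1 / real a) ^ \<alpha>" if "i \<in> {1..n}" for i
    unfolding r_eq[OF that] r1 by (simp add: n power_one_over)
  then obtain C S where S: "cantor_tree a (real a powr (- 1 / s)) C K S"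
    using K.ex_cantor_tree_of_weights[OF a s(1,2), of "\<lambda>_. \<alpha>"] by blast
  obtain C' S' where S': "cantor_tree a (real a powr (- 1 / s)) C' F S'"
    using F.ex_cantor_tree_of_weights[OF a s(1,3) \<beta>] by blast
  interpret trees: cantor_tree_pair a "real a powr (- 1 / s)" C K S C' F S'
    using S S' by (rule cantor_tree_pair.intro)
  show ?thesis
    by (rule trees.lipschitz_equivalent)
qed

end
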